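(* Let $b:\mathbb{R}^n\to\mathbb{R}^n$ and $g:\mathbb{R}^n\to\mathbb{R}^{n\times d}$ satisfy the following three assumptions. (i) There exist constants $L>0$ and $q>1$ such that $|b(x_1)-b(x_2)|\vee|g(x_1)-g(x_2)|\le L(1+|x_1|^{q-1}+|x_2|^{q-1})|x_1-x_2|$ for all $x_1,x_2\in\mathbb{R}^n$. (ii) There exist constants $l_1\ge 1$ and $\beta>0$ such that $2\langle x_1-x_2,b(x_1)-b(x_2)\rangle+l_1|g(x_1)-g(x_2)|^2\le-\beta|x_1-x_2|^2$ for all $x_1,x_2\in\mathbb{R}^n$. (iii) There exist constants $l_2\ge1$, $c_1>0$ and $\alpha>0$ such that $2\langle x,b(x)\rangle+l_2|g(x)|^2\le c_1-\alpha|x|^2$ for all $x\in\mathbb{R}^n$. Let $\theta\in(1/2,1]$ and put $$\rho_0=\frac{\alpha}{2}\wedge\frac{2\theta-1}{2\theta^2},\qquad \tilde\rho_0=\frac{\beta}{2}\wedge\frac{2\theta-1}{2\theta^2},\qquad h^*=\frac1{\rho_0}\wedge\frac1{\tilde\rho_0}.$$ Then for any $h\in(0,1)$ with $h<h^*$, the stochastic theta method with step $h$, $$X_{k+1}=X_k+\theta b(X_{k+1})h+(1-\theta)b(X_k)h+g(X_k)\Delta W_k,\qquad X_0=x_0,$$ has a unique invariant measure $\hat\pi\in\mathcal{P}(\mathbb{R}^n)$, and it converges to $\hat\pi$ in the $p$-Wasserstein distance with exponential rate for every $p\in(0,1)$. That is, there is $\xi_1>0$ such that for every $p\in(0,1)$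 and every initial value $x_0\in\mathbb{R}^n$ there is a constant $C>0$, independent of $k$, with $$W_p\big(\hat{\mathbb{P}}^h_k(x_0,\cdot),\hat\pi\big)\le C e^{-p\,\xi_1 kh}\qquad\text{for all } k\ge1.$$
   Context: $|\cdot|$ is the Euclidean norm for vectors and the Hilbert-Schmidt norm for matrices; $\langle\cdot,\cdot\rangle$ is the Euclidean inner product; $a\vee b$ and $a\wedge b$ denote the maximum and minimum. $\mathcal{P}(\mathbb{R}^n)$ is the set of Borel probability measures on $\mathbb{R}^n$ and $\mathcal{B}(\mathbb{R}^n)$ the Borel sets. $W(t)$ is a $d$-dimensional Brownian motion on a complete probability space $(\Omega,\mathcal{F},\mathbb{P})$, $h\in(0,1)$ is the time step, $t_k=kh$, and $\Delta W_k=W(t_{k+1})-W(t_k)$. Under assumption (ii) (with $b$ continuous) the implicit equation for $X_{k+1}$ has a unique solution, so the method is well defined. For $p\in(0,1)$ and $\mu_1,\mu_2\in\mathcal{P}(\mathbb{R}^n)$, the $p$-Wasserstein distance is $$W_p(\mu_1,\mu_2)=\inf_{\nu\in\mathcal{C}(\mu_1,\mu_2)}\int_{\mathbb{R}^n\times\mathbb{R}^n}|x-y|^p\,\nu(dx,dy),$$ where $\mathcal{C}(\mu_1,\mu_2)$ is the set of couplings of $\mu_1$ and $\mu_2$ (there is no power $1/p$). $\hat{\mathbb{P}}^h_k(x,\cdot)$ is the $k$-step transition probability kernel of the numerical solution, i.e. the law of $X_k$ when $X_0=x$. A measure $\hat\pi\in\mathcal{P}(\mathbb{R}^n)$ is an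 invariant measure of $X_k$ if $\hat\pi(B)=\int_{\mathbb{R}^n}\hat{\mathbb{P}}^h_k(x,B)\,\hat\pi(dx)$ for all $k\in\mathbb{N}$ and $B\in\mathcal{B}(\mathbb{R}^n)$. *)

theory Defs
  imports "HOL-Probability.Probability"
begin

section \<open>Brownian motion\<close>

text \<open>A \<open>d\<close>-dimensional standard Brownian motion, indexed by all reals but constrained only on
  \<open>[0,\<infinity>)\<close>. The last two conjuncts say that \<open>W t - W s\<close> has law \<open>N(0, (t - s) I)\<close>:
  its coordinates are independent and each is normal with variance \<open>t - s\<close>
  (\<^const>\<open>normal_density\<close> takes the standard deviation).\<close>

definition brownian_motion :: "'w measure \<Rightarrow> (real \<Rightarrow> 'w \<Rightarrow> real ^ 'd) \<Rightarrow> bool" where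
  "brownian_motion M W \<longleftrightarrow>
     prob_space M \<and>
     (\<forall>t\<ge>0. W t \<in> borel_measurable M) \<and>
     (AE \<omega> in M. W 0 \<omega> = 0) \<and>
     (AE \<omega> in M. continuous_on {0..} (\<lambda>t. W t \<omega>)) \<and>
     (\<forall>(t :: nat \<Rightarrow> real) m. 0 \<le> t 0 \<and> mono t \<longrightarrow>
        prob_space.indep_vars M (\<lambda>_. borel) (\<lambda>i \<omega>. W (t (Suc i)) \<omega> - W (t i) \<omega>) {..<m}) \<and>
     (\<forall>s t. 0 \<le> s \<and> s < t \<longrightarrow>
        prob_space.indep_vars M (\<lambda>_. borel) (\<lambda>i \<omega>. (W t \<omega> - W s \<omega>) $ i) UNIV) \<and>
     (\<forall>s t. 0 \<le> s \<and> s < t \<longrightarrow>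
        (\<forall>i. distributed M lborel (\<lambda>\<omega>. (W t \<omega> - W s \<omega>) $ i)
               (\<lambda>x. ennreal (normal_density 0 (sqrt (t - s)) x))))"


section \<open>The stochastic theta method\<close>

text \<open>Each step solves an implicit equation; the definite description denotes its solution
  whenever the drift is continuous and monotone, see \<open>theta_step_ex1\<close> below.\<close>

primrec theta_method ::
  "(real ^ 'n \<Rightarrow> real ^ 'n) \<Rightarrow> (real ^ 'n \<Rightarrow> real ^ 'd ^ 'n) \<Rightarrow> real \<Rightarrow> real \<Rightarrow>
   (real \<Rightarrow> 'w \<Rightarrow> real ^ 'd) \<Rightarrow> real ^ 'n \<Rightarrow> nat \<Rightarrow> 'w \<Rightarrow> real ^ 'n" where
  "theta_method b g \<theta> h W x0 0 = (\<lambda>\<omega>. x0)"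
| "theta_method b g \<theta> h W x0 (Suc k) = (\<lambda>\<omega>.
     let x = theta_method b g \<theta> h W x0 k \<omega>;
         \<Delta>W = W (real (Suc k) * h) \<omega> - W (real k * h) \<omega>
     in THE y. y = x + (\<theta> * h) *\<^sub>R b y + ((1 - \<theta>) * h) *\<^sub>R b x + g x *v \<Delta>W)"

lemma theta_step_ex1:
  fixes b :: "real ^ 'n \<Rightarrow> real ^ 'n"
  assumes cont: "continuous_on UNIV b"
    and mono: "\<And>x y. inner (x - y) (b x - b y) \<le> 0"
    and "0 \<le> \<theta>" "0 \<le> h"
  shows "\<exists>!y. y = x + (\<theta> * h) *\<^sub>R b y + ((1 - \<theta>) * h) *\<^sub>R b x + v"
proof -
  define a where "a = \<theta> * h"
  define F where "F = (\<lambda>y. y - a *\<^sub>R b y)"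
  have a: "0 \<le> a" using assms by (simp add: a_def)
  have exp: "norm (y - z) \<le> norm (F y - F z)" for y z
  proof -
    have "norm (y - z) * norm (y - z) = inner (y - z) (y - z)"
      by (simp add: power2_norm_eq_inner flip: power2_eq_square)
    also have "\<dots> \<le> inner (y - z) (y - z) - a * inner (y - z) (b y - b z)"
      using mult_nonneg_nonpos[OF a mono[of y z]] by simp
    also have "\<dots> = inner (y - z) (F y - F z)"
      by (simp add: F_def algebra_simps inner_diff_right inner_diff_left)
    also have "\<dots> \<le> norm (y - z) * norm (F y - F z)"
      by (rule norm_cauchy_schwarz)
    finally show ?thesis
      by (cases "y = z") auto
  qed
  have contF: "continuous_on UNIV F"
    unfolding F_def by (intro continuous_intros cont)
  have inj: "inj F"
  proof (rule injI)
    fix y z assume "F y = F z"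
    then show "y = z" using exp[of y z] by simp
  qed
  have op: "open (range F)"
    using invariance_of_domain[OF contF open_UNIV inj] .
  have "uniform_space_class.complete (range F)"
  proof (rule completeI)
    fix f assume f: "\<forall>n. f n \<in> range F" and C: "Cauchy f"
    from f have "\<forall>n. \<exists>y. f n = F y" by blast
    then have "\<exists>u. \<forall>n. f n = F (u n)" by (rule choice)
    then obtain u where u: "\<And>n. f n = F (u n)" by blast
    have "Cauchy u"
    proof (rule metric_CauchyI)
      fix e :: real assume "0 < e"
      then obtain N where N: "\<And>m n. m \<ge> N \<Longrightarrow> n \<ge> N \<Longrightarrow> dist (f m) (f n) < e"
        using metric_CauchyD[OF C] by blast
      show "\<exists>N. \<forall>m\<ge>N. \<forall>n\<ge>N. dist (u m) (u n) < e"
      proof (intro exI allI impI)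
        fix m n assume "N \<le> m" "N \<le> n"
        then have "dist (F (u m)) (F (u n)) < e" using N u by simp
        then show "dist (u m) (u n) < e"
          using exp[of "u m" "u n"] by (simp add: dist_norm)
      qed
    qed
    then obtain l where l: "u \<longlonglongrightarrow> l"
      using Cauchy_convergent convergent_def by blast
    have "(\<lambda>n. F (u n)) \<longlonglongrightarrow> F l"
      using continuous_on_tendsto_compose[OF contF l] by simp
    moreover have "f = (\<lambda>n. F (u n))" using u by (rule ext)
    ultimately show "\<exists>l\<in>range F. f \<longlonglongrightarrow> l" by blast
  qed
  then have cl: "closed (range F)" by (rule complete_imp_closed)
  have "range F = UNIV"
    using clopen[of "range F"] op cl by blast
  then have "x + ((1 - \<theta>) * h) *\<^sub>R b x + v \<in> range F" by simp
  then obtain y where y: "F y = x + ((1 - \<theta>) * h) *\<^sub>R b x + v"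
    by (elim rangeE) (rule that, rule sym)
  have eq: "z = x + (\<theta> * h) *\<^sub>R b z + ((1 - \<theta>) * h) *\<^sub>R b x + v \<longleftrightarrow>
      F z = x + ((1 - \<theta>) * h) *\<^sub>R b x + v" for z
    unfolding F_def a_def by (simp only: diff_eq_eq ac_simps)
  show ?thesis
    unfolding eq
  proof (rule ex1I)
    show "F y = x + ((1 - \<theta>) * h) *\<^sub>R b x + v" by (rule y)
    fix z assume "F z = x + ((1 - \<theta>) * h) *\<^sub>R b x + v"
    with y have "F z = F y" by simp
    then show "z = y" by (rule injD[OF inj])
  qed
qed

definition theta_kernel ::
  "(real ^ 'n \<Rightarrow> real ^ 'n) \<Rightarrow> (real ^ 'n \<Rightarrow> real ^ 'd ^ 'n) \<Rightarrow> real \<Rightarrow> real \<Rightarrow>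
   'w measure \<Rightarrow> (real \<Rightarrow> 'w \<Rightarrow> real ^ 'd) \<Rightarrow> nat \<Rightarrow> real ^ 'n \<Rightarrow> (real ^ 'n) measure" where
  "theta_kernel b g \<theta> h M W k x = distr M borel (theta_method b g \<theta> h W x k)"


section \<open>Invariant measures and the Wasserstein distance\<close>

definition borel_prob :: "'a::topological_space measure \<Rightarrow> bool" where
  "borel_prob \<mu> \<longleftrightarrow> prob_space \<mu> \<and> sets \<mu> = sets borel"

definition invariant_measure ::
  "(nat \<Rightarrow> 'a::topological_space \<Rightarrow> 'a measure) \<Rightarrow> 'a measure \<Rightarrow> bool" where
  "invariant_measure P \<pi> \<longleftrightarrow> borel_prob \<pi> \<and>
     (\<forall>k. \<forall>B\<in>sets borel. emeasure \<pi> B = (\<integral>\<^sup>+ x. emeasure (P k x) B \<partial>\<pi>))"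

definition couplings :: "'a::topological_space measure \<Rightarrow> 'a measure \<Rightarrow> ('a \<times> 'a) measure set" where
  "couplings \<mu>\<^sub>1 \<mu>\<^sub>2 = {\<nu>. prob_space \<nu> \<and> sets \<nu> = sets (borel \<Otimes>\<^sub>M borel) \<and>
     distr \<nu> borel fst = \<mu>\<^sub>1 \<and> distr \<nu> borel snd = \<mu>\<^sub>2}"

text \<open>For \<open>0 < p < 1\<close>; no outer power \<open>1/p\<close> is taken.\<close>

definition wasserstein :: "real \<Rightarrow> 'a::real_normed_vector measure \<Rightarrow> 'a measure \<Rightarrow> ennreal" where
  "wasserstein p \<mu>\<^sub>1 \<mu>\<^sub>2 =
     (INF \<nu>\<in>couplings \<mu>\<^sub>1 \<mu>\<^sub>2. \<integral>\<^sup>+ z. ennreal (norm (fst z - snd z) powr p) \<partial>\<nu>)"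

end

theory Submission
  imports Defs
begin

text \<open>The implicit equation is removed first. Put \<open>F x = x - \<theta> h b x\<close>; one-sided
monotonicity of \<open>b\<close> makes \<open>F\<close> a bijection whose inverse \<open>T\<close> does not increase distances.
In the variable \<open>U = F X\<close> the method becomes the explicit random recursion
\<open>U' = \<Psi> U \<Delta>W\<close> with \<open>\<Psi> u w = u + h b (T u) + g (T u) w\<close>.

Two copies of this recursion driven by the same noise approach each other. Since the increment is
centred with covariance \<open>h I\<close>, the mean square of \<open>\<Psi> u \<Delta>W - \<Psi> v \<Delta>W\<close> is an explicit
quadratic expression in \<open>e = T u - T v\<close>, \<open>d = b (T u) - b (T v)\<close> and \<open>g (T u) - g (T v)\<close>. Because
\<open>\<theta> > 1/2\<close> the implicit part contributes a negative multiple of \<open>|d|\<^sup>2\<close>, the coupled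
monotonicity condition contributes a negative multiple of \<open>|e|\<^sup>2\<close>, and together they dominate
\<open>\<rho>\<^sub>0' h |u - v|\<^sup>2\<close> (\<open>theta_step_contraction\<close>). Hence \<open>\<Psi>\<close> contracts in mean by the factor
\<open>s = sqrt (1 - \<rho>\<^sub>0' h) < 1\<close>.

For any iteration of i.i.d. random maps that contract in mean, the invariant law is obtained as the law
of a random variable. The forward iterate \<open>\<Psi>(\<dots>\<Psi>(\<Psi> u w\<^sub>0) w\<^sub>1 \<dots>) w\<^sub>k\<close> does not converge in
general, but it has the same law as the backward iterate \<open>\<Psi>(\<Psi>(\<dots>\<Psi> u w\<^sub>k \<dots>) w\<^sub>1) w\<^sub>0\<close>, whose
innermost step is the new one: consecutive backward iterates differ by \<open>O(s\<^sup>k)\<close> in mean, so they converge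
geometrically in mean to a limit that does not depend on \<open>u\<close> up to null sets
(\<open>V_lim_dist_le\<close>). The law of this limit is stationary, every other invariant law coincides
with it, and the pair (backward iterate, limit) is a coupling that is explicit enough to yield the
exponential rate. Both stationarity and uniqueness are tested on bounded Lipschitz functions
(\<open>borel_prob_eqI_lipschitz\<close>), for which convergence in mean gives convergence of the integrals.

Finally the result is transported back along \<open>T\<close>: invariant laws of the two recursions correspond to
each other under \<open>T\<close> and \<open>F\<close>, and distances do not increase under \<open>T\<close>. A bound \<open>m\<close> on the mean distance of a
coupling bounds the \<open>p\<close>-Wasserstein distance by \<open>2 m\<^sup>p\<close>, which keeps the rate geometric.\<close>

section \<open>Lipschitz test functions\<close>

text \<open>An additive form of the Lipschitz condition for functions with values in \<open>[0, \<infinity>]\<close>. It can be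
integrated without any integrability side condition, and the two inequalities obtained by exchanging
\<open>x\<close> and \<open>y\<close> replace the absolute value.\<close>

definition ennreal_lipschitz :: "real \<Rightarrow> ('a::metric_space \<Rightarrow> ennreal) \<Rightarrow> bool" where
  "ennreal_lipschitz K f \<longleftrightarrow> 0 \<le> K \<and> (\<forall>x y. f x \<le> f y + ennreal (K * dist x y))"

lemma nn_integral_lipschitz_le:
  fixes f :: "'a::{metric_space, second_countable_topology} \<Rightarrow> ennreal"
  assumes "ennreal_lipschitz K f"
    and [measurable]: "X \<in> borel_measurable M" "Y \<in> borel_measurable M"
      "f \<in> borel_measurable borel"
  shows "(\<integral>\<^sup>+\<omega>. f (X \<omega>) \<partial>M) \<le> (\<integral>\<^sup>+\<omega>. f (Y \<omega>) \<partial>M) + ennreal K * (\<integral>\<^sup>+\<omega>. dist (X \<omega>) (Y \<omega>) \<partial>M)"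
proof -
  have "(\<integral>\<^sup>+\<omega>. f (X \<omega>) \<partial>M) \<le> (\<integral>\<^sup>+\<omega>. f (Y \<omega>) + ennreal K * ennreal (dist (X \<omega>) (Y \<omega>)) \<partial>M)"
    using assms(1) by (intro nn_integral_mono) (auto simp: ennreal_lipschitz_def ennreal_mult')
  then show ?thesis by (simp add: nn_integral_add nn_integral_cmult)
qed

text \<open>The indicator of an open set \<open>U\<close> is the increasing limit of the Lipschitz functions
\<open>min 1 (n * infdist x (- U))\<close>, and the open sets generate the Borel sets.\<close>

lemma borel_prob_eqI_lipschitz:
  fixes \<mu> \<nu> :: "'a::metric_space measure"
  assumes \<mu>: "borel_prob \<mu>" and \<nu>: "borel_prob \<nu>"
    and eq: "\<And>f K. f \<in> borel_measurable borel \<Longrightarrow> (\<And>x. f x \<le> 1) \<Longrightarrow> ennreal_lipschitz K f \<Longrightarrow>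
      (\<integral>\<^sup>+x. f x \<partial>\<mu>) = (\<integral>\<^sup>+x. f x \<partial>\<nu>)"
  shows "\<mu> = \<nu>"
proof -
  interpret \<mu>: prob_space \<mu> using \<mu> by (simp add: borel_prob_def)
  interpret \<nu>: prob_space \<nu> using \<nu> by (simp add: borel_prob_def)
  have [measurable_cong]: "sets \<mu> = sets borel" "sets \<nu> = sets borel"
    using \<mu> \<nu> by (auto simp: borel_prob_def)
  have open_eq: "emeasure \<mu> U = emeasure \<nu> U" if U: "open U" for U :: "'a set"
    \<comment> \<open>The distance to the empty set is \<open>0\<close> by convention, so the approximation does not reach the
      indicator of the whole space.\<close>
  proof (cases "U = UNIV")
    case True
    moreover have "space \<mu> = UNIV" "space \<nu> = UNIV"
      using sets_eq_imp_space_eq[of \<mu> borel] sets_eq_imp_space_eq[of \<nu> borel] \<mu> \<nu>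
      by (auto simp: borel_prob_def)
    ultimately show ?thesis using \<mu>.emeasure_space_1 \<nu>.emeasure_space_1 by simp
  next
    case False
    define f where "f n x = ennreal (min 1 (real n * infdist x (- U)))" for n x
    have meas[measurable]: "f n \<in> borel_measurable borel" for n
    proof -
      have "continuous_on UNIV (\<lambda>x. min 1 (real n * infdist x (- U)))"
        by (intro continuous_intros)
      then have "(\<lambda>x. min 1 (real n * infdist x (- U))) \<in> borel_measurable borel"
        by (rule borel_measurable_continuous_onI)
      then show ?thesis unfolding f_def by measurable
    qed
    have inc: "incseq f"
      unfolding f_def incseq_def le_fun_def
      by (auto intro!: ennreal_leI min.mono mult_right_mono infdist_nonneg)
    have sup: "(SUP n. f n x) = indicator U x" for x
    proof (cases "x \<in> U")
      case True
      then have "infdist x (- U) \<noteq> 0"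
        using in_closed_iff_infdist_zero[of "- U" x] U False by auto
      then have pos: "infdist x (- U) > 0" using infdist_nonneg[of x "- U"] by simp
      obtain n where "1 < real n * infdist x (- U)" using pos reals_Archimedean3 by blast
      then have "f n x = 1" by (simp add: f_def min_def)
      then have "1 \<le> (SUP n. f n x)" by (metis SUP_upper UNIV_I)
      moreover have "(SUP n. f n x) \<le> 1"
        by (intro SUP_least) (auto simp: f_def)
      ultimately have "(SUP n. f n x) = 1" by (rule antisym[rotated])
      then show ?thesis using True by simp
    next
      case False
      then show ?thesis by (simp add: f_def)
    qed
    have lip: "ennreal_lipschitz (real n) (f n)" for n
      unfolding ennreal_lipschitz_def
    proof (intro conjI allI)
      fix x y
      have "real n * infdist x (- U) \<le> real n * infdist y (- U) + real n * dist x y"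
        using mult_left_mono[OF infdist_triangle[of x "- U" y], of "real n"]
        by (simp add: distrib_left)
      moreover have "0 \<le> real n * dist x y" by simp
      ultimately have "min 1 (real n * infdist x (- U)) \<le> min 1 (real n * infdist y (- U)) + real n * dist x y"
        by linarith
      then show "f n x \<le> f n y + ennreal (real n * dist x y)"
        unfolding f_def by (subst ennreal_plus[symmetric]) (auto intro!: ennreal_leI simp: infdist_nonneg simp del: ennreal_plus)
    qed simp
    have *: "emeasure \<kappa> U = (SUP n. \<integral>\<^sup>+x. f n x \<partial>\<kappa>)" if [measurable_cong]: "sets \<kappa> = sets borel" for \<kappa>
    proof -
      have "emeasure \<kappa> U = (\<integral>\<^sup>+x. (SUP n. f n x) \<partial>\<kappa>)"
        using U by (simp add: sup)
      also have "\<dots> = (SUP n. \<integral>\<^sup>+x. f n x \<partial>\<kappa>)"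
        by (rule nn_integral_monotone_convergence_SUP[OF inc]) simp
      finally show ?thesis .
    qed
    have "(\<integral>\<^sup>+x. f n x \<partial>\<mu>) = (\<integral>\<^sup>+x. f n x \<partial>\<nu>)" for n
      by (rule eq[OF meas _ lip]) (auto simp: f_def)
    then show ?thesis
      using \<mu> \<nu> by (simp add: * borel_prob_def)
  qed
  show ?thesis
  proof (rule measure_eqI_generator_eq[where \<Omega> = UNIV and E = "{U. open U}" and A = "\<lambda>_. UNIV"])
    show "Int_stable {U::'a set. open U}" by (auto simp: Int_stable_def)
    show "sets \<mu> = sigma_sets UNIV {U. open U}" "sets \<nu> = sigma_sets UNIV {U. open U}"
      using \<mu> \<nu> by (auto simp: borel_prob_def borel_def)
  qed (auto simp: open_eq)
qed


section \<open>Iterating an average contraction\<close>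

primrec forward_iterate :: "('a \<Rightarrow> 'e \<Rightarrow> 'a) \<Rightarrow> nat \<Rightarrow> 'a \<Rightarrow> (nat \<Rightarrow> 'e) \<Rightarrow> 'a" where
  "forward_iterate \<Psi> 0 u e = u"
| "forward_iterate \<Psi> (Suc k) u e = \<Psi> (forward_iterate \<Psi> k u e) (e k)"

text \<open>The same number of steps with the noise consumed in the opposite order: the newest value \<open>e k\<close> acts
first and \<open>e 0\<close> acts last, so passing from \<open>k\<close> to \<open>k + 1\<close> only changes the starting point of a
composition of \<open>k\<close> maps.\<close>

primrec backward_iterate :: "('a \<Rightarrow> 'e \<Rightarrow> 'a) \<Rightarrow> nat \<Rightarrow> 'a \<Rightarrow> (nat \<Rightarrow> 'e) \<Rightarrow> 'a" where
  "backward_iterate \<Psi> 0 u e = u"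
| "backward_iterate \<Psi> (Suc k) u e = backward_iterate \<Psi> k (\<Psi> u (e k)) e"

lemma forward_iterate_restrict:
  "{..<k} \<subseteq> I \<Longrightarrow> forward_iterate \<Psi> k u (restrict e I) = forward_iterate \<Psi> k u e"
  by (induction k) (auto simp: lessThan_Suc)

lemma backward_iterate_restrict:
  "{..<k} \<subseteq> I \<Longrightarrow> backward_iterate \<Psi> k u (restrict e I) = backward_iterate \<Psi> k u e"
  by (induction k arbitrary: u) (auto simp: lessThan_Suc)

text \<open>Independence is asked for on initial segments because only finitely many noise variables enter an iterate.
The moment condition fixes one starting point; by the contraction it then
holds at every point.\<close>

locale average_contraction = prob_space M for M :: "'w measure" +
  fixes S N :: "'e measure" and \<xi> :: "nat \<Rightarrow> 'w \<Rightarrow> 'e"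
    and \<Psi> :: "'a::{banach, second_countable_topology} \<Rightarrow> 'e \<Rightarrow> 'a" and s :: real
  assumes noise_indep: "\<And>k. indep_vars (\<lambda>_. S) \<xi> {..<k}"
    and noise_law: "\<And>k. distr M S (\<xi> k) = N"
    and map_measurable: "(\<lambda>(u, w). \<Psi> u w) \<in> borel_measurable (borel \<Otimes>\<^sub>M S)"
    and rate: "0 < s" "s < 1"
    and contraction: "\<And>u v. (\<integral>\<^sup>+w. dist (\<Psi> u w) (\<Psi> v w) \<partial>N) \<le> ennreal (s * dist u v)"
    and moment: "(\<integral>\<^sup>+w. dist (\<Psi> 0 w) 0 \<partial>N) < \<infinity>"
begin

lemma noise_measurable[measurable]: "\<xi> k \<in> measurable M S"
  using noise_indep[of "Suc k"] by (auto simp: indep_vars_def)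

lemma sets_noise[measurable_cong, simp]: "sets N = sets S"
  using noise_law[of 0] by auto

sublocale noise: prob_space N
  using noise_law[of 0] by (metis noise_measurable prob_space_distr)

lemma step_measurable[measurable (raw)]:
  assumes [measurable]: "f \<in> borel_measurable K" "w \<in> measurable K S"
  shows "(\<lambda>x. \<Psi> (f x) (w x)) \<in> borel_measurable K"
  using measurable_compose[OF _ map_measurable, of "\<lambda>x. (f x, w x)" K] by simp

lemma forward_measurable_PiM:
  "{..<k} \<subseteq> I \<Longrightarrow> forward_iterate \<Psi> k u \<in> borel_measurable (PiM I (\<lambda>_. S))"
proof (induction k)
  case 0
  have "forward_iterate \<Psi> 0 u = (\<lambda>_. u)" by auto
  then show ?case by simp
next
  case (Suc k)
  have [measurable]: "(\<lambda>e. e k) \<in> measurable (PiM I (\<lambda>_. S)) S"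
    using Suc.prems by (intro measurable_component_singleton) auto
  have [measurable]: "forward_iterate \<Psi> k u \<in> borel_measurable (PiM I (\<lambda>_. S))"
    using Suc.prems by (intro Suc.IH) auto
  show ?case by simp
qed

lemma backward_measurable_PiM:
  "{..<k} \<subseteq> I \<Longrightarrow> (\<lambda>(u, e). backward_iterate \<Psi> k u e) \<in> borel_measurable (borel \<Otimes>\<^sub>M PiM I (\<lambda>_. S))"
proof (induction k)
  case (Suc k)
  have [measurable]: "(\<lambda>e. e k) \<in> measurable (PiM I (\<lambda>_. S)) S"
    using Suc.prems by (intro measurable_component_singleton) auto
  have "(\<lambda>(u, e). backward_iterate \<Psi> k u e) \<in> borel_measurable (borel \<Otimes>\<^sub>M PiM I (\<lambda>_. S))"
    using Suc.prems by (intro Suc.IH) auto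
  from measurable_compose[OF _ this, of "\<lambda>(u, e). (\<Psi> u (e k), e)" "borel \<Otimes>\<^sub>M PiM I (\<lambda>_. S)"]
  show ?case by (simp add: case_prod_beta')
qed (simp add: case_prod_beta')

lemma backward_after_step_measurable[measurable]:
  assumes "f \<in> borel_measurable (S \<Otimes>\<^sub>M PiM {..<k} (\<lambda>_. S))"
  shows "(\<lambda>p. backward_iterate \<Psi> k (f p) (snd p)) \<in> borel_measurable (S \<Otimes>\<^sub>M PiM {..<k} (\<lambda>_. S))"
  using measurable_compose[OF measurable_Pair[OF assms measurable_snd]
      backward_measurable_PiM[of k "{..<k}"]] by simp

text \<open>\<open>U\<close> is the Markov chain itself; \<open>V\<close> has the same law at each time and converges.\<close>

abbreviation "U k u \<omega> \<equiv> forward_iterate \<Psi> k u (\<lambda>i. \<xi> i \<omega>)"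
abbreviation "V k u \<omega> \<equiv> backward_iterate \<Psi> k u (\<lambda>i. \<xi> i \<omega>)"

lemma past_measurable[measurable]: "(\<lambda>\<omega>. \<lambda>i\<in>{..<k}. \<xi> i \<omega>) \<in> measurable M (PiM {..<k} (\<lambda>_. S))"
  by (intro measurable_restrict) simp

lemma forward_measurable[measurable]: "U k u \<in> borel_measurable M"
  using measurable_compose[OF past_measurable forward_measurable_PiM[of k "{..<k}" u]]
  by (simp add: forward_iterate_restrict)

lemma backward_measurable[measurable]: "V k u \<in> borel_measurable M"
proof -
  have "(\<lambda>\<omega>. (u, \<lambda>i\<in>{..<k}. \<xi> i \<omega>)) \<in> measurable M (borel \<Otimes>\<^sub>M PiM {..<k} (\<lambda>_. S))"
    by measurable
  from measurable_compose[OF this backward_measurable_PiM[of k "{..<k}"]]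
  show ?thesis by (simp add: backward_iterate_restrict)
qed

text \<open>The noise at time \<open>k\<close> is independent of the noise before time \<open>k\<close>, so Fubini's theorem applies to
functions of the two; the forward iterates integrate out the new noise first, the backward iterates
integrate out the past first.\<close>

lemma condition_on_noise:
  assumes H[measurable]: "H \<in> borel_measurable (S \<Otimes>\<^sub>M PiM {..<k} (\<lambda>_. S))"
  shows "(\<integral>\<^sup>+\<omega>. H (\<xi> k \<omega>, \<lambda>i\<in>{..<k}. \<xi> i \<omega>) \<partial>M) = (\<integral>\<^sup>+w. (\<integral>\<^sup>+\<omega>. H (w, \<lambda>i\<in>{..<k}. \<xi> i \<omega>) \<partial>M) \<partial>N)"
    and "(\<integral>\<^sup>+\<omega>. H (\<xi> k \<omega>, \<lambda>i\<in>{..<k}. \<xi> i \<omega>) \<partial>M) = (\<integral>\<^sup>+\<omega>. (\<integral>\<^sup>+w. H (w, \<lambda>i\<in>{..<k}. \<xi> i \<omega>) \<partial>N) \<partial>M)"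
proof -
  let ?P = "\<lambda>\<omega>. \<lambda>i\<in>{..<k}. \<xi> i \<omega>" and ?S = "PiM {..<k} (\<lambda>_. S)"
  let ?Q = "\<lambda>\<omega>. \<lambda>i\<in>{k}. \<xi> i \<omega>" and ?T = "PiM {k} (\<lambda>_. S)"
  have Q[measurable]: "?Q \<in> measurable M ?T"
    by (intro measurable_restrict) simp
  have [measurable]: "(\<lambda>e. e k) \<in> measurable ?T S"
    by (intro measurable_component_singleton) simp
  have "indep_var ?T ?Q ?S ?P"
    by (rule indep_var_restrict[OF noise_indep[of "Suc k"]]) auto
  then have joint: "distr M ?T ?Q \<Otimes>\<^sub>M distr M ?S ?P = distr M (?T \<Otimes>\<^sub>M ?S) (\<lambda>\<omega>. (?Q \<omega>, ?P \<omega>))"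
    by (simp add: indep_var_distribution_eq)
  interpret past: prob_space "distr M ?S ?P"
    by (rule prob_space_distr) simp
  interpret new: prob_space "distr M ?T ?Q"
    by (rule prob_space_distr) simp
  interpret pair_sigma_finite "distr M ?T ?Q" "distr M ?S ?P" ..
  let ?G = "\<lambda>p. H (fst p k, snd p)"
  have eq: "(\<integral>\<^sup>+\<omega>. H (\<xi> k \<omega>, ?P \<omega>) \<partial>M) = integral\<^sup>N (distr M ?T ?Q \<Otimes>\<^sub>M distr M ?S ?P) ?G"
    by (simp add: joint nn_integral_distr)
  have new: "(\<integral>\<^sup>+e. f (e k) \<partial>distr M ?T ?Q) = (\<integral>\<^sup>+w. f w \<partial>N)" if [measurable]: "f \<in> borel_measurable S" for f
    by (simp add: nn_integral_distr noise_law[of k, symmetric])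
  have "integral\<^sup>N (distr M ?T ?Q \<Otimes>\<^sub>M distr M ?S ?P) ?G
      = (\<integral>\<^sup>+e. (\<integral>\<^sup>+p. H (e k, p) \<partial>distr M ?S ?P) \<partial>distr M ?T ?Q)"
    by (subst past.nn_integral_fst[symmetric]) auto
  also have "\<dots> = (\<integral>\<^sup>+w. (\<integral>\<^sup>+p. H (w, p) \<partial>distr M ?S ?P) \<partial>N)"
    by (rule new) measurable
  also have "\<dots> = (\<integral>\<^sup>+w. (\<integral>\<^sup>+\<omega>. H (w, ?P \<omega>) \<partial>M) \<partial>N)"
    by (intro nn_integral_cong nn_integral_distr past_measurable measurable_compose[OF measurable_Pair1' H])
      (simp add: sets_eq_imp_space_eq[OF sets_noise])
  finally show "(\<integral>\<^sup>+\<omega>. H (\<xi> k \<omega>, ?P \<omega>) \<partial>M) = (\<integral>\<^sup>+w. (\<integral>\<^sup>+\<omega>. H (w, ?P \<omega>) \<partial>M) \<partial>N)"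
    using eq by simp
  have "integral\<^sup>N (distr M ?T ?Q \<Otimes>\<^sub>M distr M ?S ?P) ?G
      = (\<integral>\<^sup>+p. (\<integral>\<^sup>+e. H (e k, p) \<partial>distr M ?T ?Q) \<partial>distr M ?S ?P)"
    by (subst nn_integral_snd[symmetric]) auto
  also have "\<dots> = (\<integral>\<^sup>+\<omega>. (\<integral>\<^sup>+e. H (e k, ?P \<omega>) \<partial>distr M ?T ?Q) \<partial>M)"
    by (rule nn_integral_distr) measurable
  also have "\<dots> = (\<integral>\<^sup>+\<omega>. (\<integral>\<^sup>+w. H (w, ?P \<omega>) \<partial>N) \<partial>M)"
    by (intro nn_integral_cong new measurable_compose[OF _ H] measurable_Pair
        measurable_ident_sets measurable_const measurable_space[OF past_measurable]) auto
  finally show "(\<integral>\<^sup>+\<omega>. H (\<xi> k \<omega>, ?P \<omega>) \<partial>M) = (\<integral>\<^sup>+\<omega>. (\<integral>\<^sup>+w. H (w, ?P \<omega>) \<partial>N) \<partial>M)"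
    using eq by simp
qed

text \<open>The Markov operator of one step. The law of the chain after \<open>k\<close> steps is determined by the powers of this
operator, for which forward and backward order agree.\<close>

definition avg :: "('a \<Rightarrow> ennreal) \<Rightarrow> 'a \<Rightarrow> ennreal" where
  "avg f u = (\<integral>\<^sup>+w. f (\<Psi> u w) \<partial>N)"

lemma avg_measurable[measurable]:
  assumes [measurable]: "f \<in> borel_measurable borel"
  shows "avg f \<in> borel_measurable borel"
  unfolding avg_def[abs_def] by measurable

lemma avg_power_measurable[measurable]:
  "f \<in> borel_measurable borel \<Longrightarrow> (avg ^^ k) f \<in> borel_measurable borel"
  by (induction k) auto

text \<open>A backward iterate starts with the newest noise, so conditioning on it peels off the outermost factor
of \<open>avg ^^ Suc k = avg \<circ> avg ^^ k\<close>.\<close>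

lemma backward_law:
  assumes [measurable]: "f \<in> borel_measurable borel"
  shows "(\<integral>\<^sup>+\<omega>. f (V k u \<omega>) \<partial>M) = (avg ^^ k) f u"
proof (induction k arbitrary: u)
  case (Suc k)
  show ?case
    using condition_on_noise(1)[of "\<lambda>p. f (backward_iterate \<Psi> k (\<Psi> u (fst p)) (snd p))" k] Suc.IH
    by (simp add: backward_iterate_restrict avg_def)
qed (simp add: emeasure_space_1)

text \<open>A forward iterate ends with the newest noise, so the factor peeled off is the innermost one:
\<open>avg ^^ Suc k = avg ^^ k \<circ> avg\<close>. Since \<open>avg\<close> commutes with its powers, the law is that of the backward
iterate.\<close>

lemma forward_law:
  assumes "f \<in> borel_measurable borel"
  shows "(\<integral>\<^sup>+\<omega>. f (U k u \<omega>) \<partial>M) = (avg ^^ k) f u"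
  using assms
proof (induction k arbitrary: f)
  case (Suc k)
  note [measurable] = Suc.prems forward_measurable_PiM[of k "{..<k}" u, simplified]
  have "(\<integral>\<^sup>+\<omega>. f (U (Suc k) u \<omega>) \<partial>M) = (\<integral>\<^sup>+\<omega>. avg f (U k u \<omega>) \<partial>M)"
    using condition_on_noise(2)[of "\<lambda>p. f (\<Psi> (forward_iterate \<Psi> k u (snd p)) (fst p))" k]
    by (simp add: forward_iterate_restrict avg_def)
  also have "\<dots> = (avg ^^ k) (avg f) u"
    by (rule Suc.IH) simp
  finally show ?case by (simp add: funpow_swap1)
qed (simp add: emeasure_space_1)

text \<open>Given the newest noise \<open>w\<close>, the remaining \<open>k\<close> maps act on the two starting points \<open>\<Psi> u w\<close> and
\<open>\<Psi> v w\<close>, so their factor \<open>s ^ k\<close> multiplies the factor \<open>s\<close> of the newest step.\<close>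

lemma backward_dist_le:
  "(\<integral>\<^sup>+\<omega>. dist (V k u \<omega>) (V k v \<omega>) \<partial>M) \<le> ennreal (s ^ k * dist u v)"
proof (induction k arbitrary: u v)
  case (Suc k)
  have "(\<integral>\<^sup>+\<omega>. dist (V (Suc k) u \<omega>) (V (Suc k) v \<omega>) \<partial>M)
      = (\<integral>\<^sup>+w. (\<integral>\<^sup>+\<omega>. dist (V k (\<Psi> u w) \<omega>) (V k (\<Psi> v w) \<omega>) \<partial>M) \<partial>N)"
    using condition_on_noise(1)[of "\<lambda>p. ennreal (dist (backward_iterate \<Psi> k (\<Psi> u (fst p)) (snd p))
      (backward_iterate \<Psi> k (\<Psi> v (fst p)) (snd p)))" k]
    by (simp add: backward_iterate_restrict)
  also have "\<dots> \<le> (\<integral>\<^sup>+w. ennreal (s ^ k) * ennreal (dist (\<Psi> u w) (\<Psi> v w)) \<partial>N)"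
    using Suc.IH rate by (intro nn_integral_mono) (simp add: ennreal_mult'[symmetric])
  also have "\<dots> = ennreal (s ^ k) * (\<integral>\<^sup>+w. dist (\<Psi> u w) (\<Psi> v w) \<partial>N)"
    by (rule nn_integral_cmult) measurable
  also have "\<dots> \<le> ennreal (s ^ k) * ennreal (s * dist u v)"
    by (intro mult_left_mono contraction) simp
  also have "\<dots> = ennreal (s ^ Suc k * dist u v)"
    using rate by (simp add: ennreal_mult'[symmetric] mult.assoc mult.left_commute)
  finally show ?case .
qed (simp add: emeasure_space_1)

definition first_step :: real where
  "first_step = enn2real (\<integral>\<^sup>+w. dist (\<Psi> 0 w) 0 \<partial>N)"

lemma first_step_nonneg: "0 \<le> first_step"
  by (simp add: first_step_def)

text \<open>Two consecutive backward iterates are the same \<open>k\<close>-fold composition evaluated at the points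
\<open>\<Psi> 0 w\<close> and \<open>0\<close>, where \<open>w\<close> is the newest noise. Conditionally on \<open>w\<close> their mean distance is at most
\<open>s ^ k\<close> times the distance of these points.\<close>

lemma backward_increment_le:
  "(\<integral>\<^sup>+\<omega>. dist (V (Suc k) 0 \<omega>) (V k 0 \<omega>) \<partial>M) \<le> ennreal (s ^ k * first_step)"
proof -
  have "(\<integral>\<^sup>+\<omega>. dist (V (Suc k) 0 \<omega>) (V k 0 \<omega>) \<partial>M)
      = (\<integral>\<^sup>+w. (\<integral>\<^sup>+\<omega>. dist (V k (\<Psi> 0 w) \<omega>) (V k 0 \<omega>) \<partial>M) \<partial>N)"
    using condition_on_noise(1)[of "\<lambda>p. ennreal (dist (backward_iterate \<Psi> k (\<Psi> 0 (fst p)) (snd p))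
      (backward_iterate \<Psi> k 0 (snd p)))" k]
    by (simp add: backward_iterate_restrict)
  also have "\<dots> \<le> (\<integral>\<^sup>+w. ennreal (s ^ k) * ennreal (dist (\<Psi> 0 w) 0) \<partial>N)"
    using backward_dist_le[of k _ 0] rate by (intro nn_integral_mono) (simp add: ennreal_mult'[symmetric])
  also have "\<dots> = ennreal (s ^ k) * (\<integral>\<^sup>+w. dist (\<Psi> 0 w) 0 \<partial>N)"
    by (rule nn_integral_cmult) measurable
  also have "\<dots> = ennreal (s ^ k * first_step)"
    using rate moment by (simp add: ennreal_mult' first_step_def)
  finally show ?thesis .
qed

text \<open>The limit of the backward iterates started at \<open>0\<close>, written as a telescoping series. Where the series
does not converge absolutely its value is irrelevant: the estimate below then has an infinite right-hand side.\<close>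

definition V_lim :: "'w \<Rightarrow> 'a" where
  "V_lim \<omega> = (\<Sum>j. V (Suc j) 0 \<omega> - V j 0 \<omega>)"

lemma V_lim_measurable[measurable]: "V_lim \<in> borel_measurable M"
  unfolding V_lim_def[abs_def] by (intro borel_measurable_suminf borel_measurable_diff backward_measurable)

lemma V_lim_tail:
  "ennreal (dist (V k 0 \<omega>) (V_lim \<omega>)) \<le> (\<Sum>j. ennreal (dist (V (Suc (j + k)) 0 \<omega>) (V (j + k) 0 \<omega>)))"
proof (cases "(\<Sum>j. ennreal (dist (V (Suc (j + k)) 0 \<omega>) (V (j + k) 0 \<omega>))) = \<top>")
  case False
  define D where "D j = V (Suc j) 0 \<omega> - V j 0 \<omega>" for j
  have n: "summable (\<lambda>j. norm (D (j + k)))"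
    using summable_suminf_not_top[OF _ False] by (simp add: D_def dist_norm)
  then have sk: "summable (\<lambda>j. D (j + k))" by (rule summable_norm_cancel)
  then have "summable D" by (subst (asm) summable_iff_shift)
  then have "V_lim \<omega> = (\<Sum>j. D (j + k)) + (\<Sum>i<k. D i)"
    unfolding V_lim_def D_def by (rule suminf_split_initial_segment)
  also have "(\<Sum>i<k. D i) = V k 0 \<omega>"
    unfolding D_def by (subst sum_lessThan_telescope) simp
  finally have "dist (V k 0 \<omega>) (V_lim \<omega>) = norm (\<Sum>j. D (j + k))"
    by (simp add: dist_norm)
  also have "\<dots> \<le> (\<Sum>j. norm (D (j + k)))"
    by (rule summable_norm[OF n])
  finally have "ennreal (dist (V k 0 \<omega>) (V_lim \<omega>)) \<le> ennreal (\<Sum>j. norm (D (j + k)))"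
    by (rule ennreal_leI)
  also have "\<dots> = (\<Sum>j. ennreal (norm (D (j + k))))"
    by (rule suminf_ennreal2[symmetric]) (use n in auto)
  finally show ?thesis by (simp add: D_def dist_norm)
qed simp

text \<open>The tail of the telescoping series is summed by its geometric bound; a starting point other than \<open>0\<close>
costs one application of the contraction.\<close>

lemma V_lim_dist_le:
  "(\<integral>\<^sup>+\<omega>. dist (V k u \<omega>) (V_lim \<omega>) \<partial>M) \<le> ennreal ((dist u 0 + first_step / (1 - s)) * s ^ k)"
proof -
  have geo: "(\<lambda>j. s ^ (j + k) * first_step) sums (s ^ k * first_step / (1 - s))"
    using sums_mult[OF geometric_sums[of s], of "s ^ k * first_step"] rate
    by (simp add: power_add mult.commute mult.left_commute)
  have "(\<integral>\<^sup>+\<omega>. dist (V k 0 \<omega>) (V_lim \<omega>) \<partial>M)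
      \<le> (\<integral>\<^sup>+\<omega>. (\<Sum>j. ennreal (dist (V (Suc (j + k)) 0 \<omega>) (V (j + k) 0 \<omega>))) \<partial>M)"
    by (intro nn_integral_mono V_lim_tail)
  also have "\<dots> = (\<Sum>j. \<integral>\<^sup>+\<omega>. dist (V (Suc (j + k)) 0 \<omega>) (V (j + k) 0 \<omega>) \<partial>M)"
    by (intro nn_integral_suminf measurable_compose[OF _ measurable_ennreal]
        borel_measurable_dist backward_measurable)
  also have "\<dots> \<le> (\<Sum>j. ennreal (s ^ (j + k) * first_step))"
    by (intro suminf_le backward_increment_le) auto
  also have "\<dots> = ennreal (s ^ k * first_step / (1 - s))"
    using geo rate first_step_nonneg by (intro suminf_ennreal_eq) auto
  finally have 0: "(\<integral>\<^sup>+\<omega>. dist (V k 0 \<omega>) (V_lim \<omega>) \<partial>M) \<le> ennreal (s ^ k * first_step / (1 - s))" .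
  have "(\<integral>\<^sup>+\<omega>. dist (V k u \<omega>) (V_lim \<omega>) \<partial>M)
      \<le> (\<integral>\<^sup>+\<omega>. ennreal (dist (V k u \<omega>) (V k 0 \<omega>)) + ennreal (dist (V k 0 \<omega>) (V_lim \<omega>)) \<partial>M)"
    by (intro nn_integral_mono) (simp add: ennreal_plus[symmetric] dist_triangle del: ennreal_plus)
  also have "\<dots> = (\<integral>\<^sup>+\<omega>. dist (V k u \<omega>) (V k 0 \<omega>) \<partial>M) + (\<integral>\<^sup>+\<omega>. dist (V k 0 \<omega>) (V_lim \<omega>) \<partial>M)"
    by (rule nn_integral_add) measurable
  also have "\<dots> \<le> ennreal (s ^ k * dist u 0) + ennreal (s ^ k * first_step / (1 - s))"
    by (intro add_mono backward_dist_le 0)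
  also have "\<dots> = ennreal ((dist u 0 + first_step / (1 - s)) * s ^ k)"
    using rate first_step_nonneg by (simp add: ennreal_plus[symmetric] algebra_simps del: ennreal_plus)
  finally show ?thesis .
qed

lemma V_lim_dist_tendsto: "(\<lambda>k. ennreal K * (\<integral>\<^sup>+\<omega>. dist (V k u \<omega>) (V_lim \<omega>) \<partial>M)) \<longlonglongrightarrow> 0"
proof (rule tendsto_sandwich[OF _ _ tendsto_const])
  let ?C = "dist u 0 + first_step / (1 - s)"
  show "\<forall>\<^sub>F k in sequentially. ennreal K * (\<integral>\<^sup>+\<omega>. dist (V k u \<omega>) (V_lim \<omega>) \<partial>M) \<le> ennreal (max 0 K * (?C * s ^ k))"
    using mult_left_mono[OF V_lim_dist_le[of _ u], of "ennreal K"]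
    by (intro always_eventually allI) (auto simp: ennreal_mult' max_def ennreal_neg)
  have "(\<lambda>k. max 0 K * (?C * s ^ k)) \<longlonglongrightarrow> max 0 K * (?C * 0)"
    using rate by (intro tendsto_intros LIMSEQ_realpow_zero) auto
  then show "(\<lambda>k. ennreal (max 0 K * (?C * s ^ k))) \<longlonglongrightarrow> 0"
    using tendsto_ennrealI by fastforce
qed simp

lemma backward_lipschitz_tendsto:
  assumes f: "ennreal_lipschitz K f" and [measurable]: "f \<in> borel_measurable borel"
  and le: "\<And>x. f x \<le> 1"
  shows "(\<lambda>k. (avg ^^ k) f u) \<longlonglongrightarrow> (\<integral>\<^sup>+\<omega>. f (V_lim \<omega>) \<partial>M)"
proof (rule tendsto_sandwich)
  let ?d = "\<lambda>k. ennreal K * (\<integral>\<^sup>+\<omega>. dist (V k u \<omega>) (V_lim \<omega>) \<partial>M)"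
  let ?l = "\<integral>\<^sup>+\<omega>. f (V_lim \<omega>) \<partial>M"
  have "?l \<le> (\<integral>\<^sup>+\<omega>. 1 \<partial>M)" by (intro nn_integral_mono le)
  then have fin: "?l < \<top>" by (simp add: emeasure_space_1 order_le_less_trans)
  have up: "(avg ^^ k) f u \<le> ?l + ?d k" for k
    unfolding backward_law[symmetric, OF assms(2)] by (rule nn_integral_lipschitz_le[OF f]) measurable
  then show "\<forall>\<^sub>F k in sequentially. (avg ^^ k) f u \<le> ?l + ?d k" by simp
  have "?l \<le> (avg ^^ k) f u + ?d k" for k
    unfolding backward_law[symmetric, OF assms(2)]
    using nn_integral_lipschitz_le[OF f, of V_lim M "V k u"] by (simp add: dist_commute)
  then show "\<forall>\<^sub>F k in sequentially. ?l - ?d k \<le> (avg ^^ k) f u"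
    using fin by (intro always_eventually allI) (auto simp: ennreal_minus_le_iff add.commute)
  show "(\<lambda>k. ?l + ?d k) \<longlonglongrightarrow> ?l"
    using tendsto_add[OF tendsto_const V_lim_dist_tendsto, of ?l K u] by simp
  show "(\<lambda>k. ?l - ?d k) \<longlonglongrightarrow> ?l"
    using tendsto_diff_ennreal_general[OF tendsto_const V_lim_dist_tendsto, of ?l K u] fin by simp
qed

definition limit_law :: "'a measure" where
  "limit_law = distr M borel V_lim"

lemma borel_prob_limit_law: "borel_prob limit_law"
  unfolding limit_law_def borel_prob_def by (auto intro: prob_space_distr)

lemma avg_le_1: "f \<in> borel_measurable borel \<Longrightarrow> (\<And>x. f x \<le> 1) \<Longrightarrow> avg f u \<le> 1"
  unfolding avg_def using nn_integral_mono[of N "\<lambda>w. f (\<Psi> u w)" "\<lambda>_. 1"]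
  by (simp add: noise.emeasure_space_1)

lemma avg_power_le_1:
  assumes "f \<in> borel_measurable borel" "\<And>x. f x \<le> 1"
  shows "(avg ^^ k) f u \<le> 1"
  using assms by (induction k arbitrary: u) (auto intro!: avg_le_1)

text \<open>The Markov operator maps Lipschitz functions to Lipschitz functions. This Feller-type property lets
\<open>backward_lipschitz_tendsto\<close> be applied to \<open>avg f\<close> as well as to \<open>f\<close>.\<close>

lemma ennreal_lipschitz_avg:
  assumes f: "ennreal_lipschitz K f" and [measurable]: "f \<in> borel_measurable borel"
  shows "ennreal_lipschitz K (avg f)"
  unfolding ennreal_lipschitz_def
proof (intro conjI allI)
  show "0 \<le> K" using f by (simp add: ennreal_lipschitz_def)
  fix u v
  have "avg f u \<le> avg f v + ennreal K * (\<integral>\<^sup>+w. dist (\<Psi> u w) (\<Psi> v w) \<partial>N)"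
    unfolding avg_def by (rule nn_integral_lipschitz_le[OF f]) measurable
  also have "ennreal K * (\<integral>\<^sup>+w. dist (\<Psi> u w) (\<Psi> v w) \<partial>N) \<le> ennreal K * ennreal (s * dist u v)"
    by (intro mult_left_mono contraction) simp
  also have "\<dots> \<le> ennreal K * ennreal (dist u v)"
    using rate by (intro mult_left_mono ennreal_leI mult_left_le_one_le) auto
  also have "\<dots> = ennreal (K * dist u v)"
    using \<open>0 \<le> K\<close> by (simp add: ennreal_mult')
  finally show "avg f u \<le> avg f v + ennreal (K * dist u v)"
    by (simp add: add_left_mono)
qed

text \<open>Both integrals are limits of the same sequence: \<open>avg ^^ k\<close> applied to \<open>avg f\<close> is \<open>avg ^^ Suc k\<close>
applied to \<open>f\<close>.\<close>

lemma limit_law_stationary_lipschitz: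
  assumes f: "ennreal_lipschitz K f" and [measurable]: "f \<in> borel_measurable borel"
    and le: "\<And>x. f x \<le> 1"
  shows "(\<integral>\<^sup>+u. avg f u \<partial>limit_law) = (\<integral>\<^sup>+u. f u \<partial>limit_law)"
proof -
  have "(\<lambda>k. (avg ^^ k) (avg f) 0) \<longlonglongrightarrow> (\<integral>\<^sup>+\<omega>. avg f (V_lim \<omega>) \<partial>M)"
    by (rule backward_lipschitz_tendsto[OF ennreal_lipschitz_avg[OF f]]) (auto intro: avg_le_1 le)
  moreover have "(\<lambda>k. (avg ^^ Suc k) f 0) \<longlonglongrightarrow> (\<integral>\<^sup>+\<omega>. f (V_lim \<omega>) \<partial>M)"
    by (rule LIMSEQ_Suc[OF backward_lipschitz_tendsto[OF f]]) (auto intro: le)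
  ultimately show ?thesis
    by (auto simp: limit_law_def nn_integral_distr funpow_swap1 intro: LIMSEQ_unique)
qed

text \<open>Applying one step to the limit law gives a Borel probability measure; by the previous lemma it agrees with
the limit law on Lipschitz functions, hence everywhere.\<close>

lemma limit_law_stationary:
  assumes [measurable]: "f \<in> borel_measurable borel"
  shows "(\<integral>\<^sup>+u. avg f u \<partial>limit_law) = (\<integral>\<^sup>+u. f u \<partial>limit_law)"
proof -
  let ?\<mu> = "distr (limit_law \<Otimes>\<^sub>M N) borel (\<lambda>p. \<Psi> (fst p) (snd p))"
  interpret l: prob_space limit_law using borel_prob_limit_law by (simp add: borel_prob_def)
  have [measurable_cong]: "sets limit_law = sets borel"
    using borel_prob_limit_law by (simp add: borel_prob_def)
  interpret pair_prob_space limit_law N ..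
  have push: "(\<integral>\<^sup>+u. f u \<partial>?\<mu>) = (\<integral>\<^sup>+u. avg f u \<partial>limit_law)"
    if [measurable]: "f \<in> borel_measurable borel" for f
    by (simp add: nn_integral_distr avg_def noise.nn_integral_fst[symmetric])
  have "?\<mu> = limit_law"
  proof (rule borel_prob_eqI_lipschitz)
    show "borel_prob ?\<mu>"
      unfolding borel_prob_def by (auto intro!: prob_space_distr)
  qed (auto simp: push borel_prob_limit_law limit_law_stationary_lipschitz)
  then show ?thesis using push[OF assms] by simp
qed

lemma limit_law_stationary_power:
  "f \<in> borel_measurable borel \<Longrightarrow> (\<integral>\<^sup>+u. (avg ^^ k) f u \<partial>limit_law) = (\<integral>\<^sup>+u. f u \<partial>limit_law)"
  by (induction k) (auto simp: limit_law_stationary)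

lemma emeasure_kernel:
  assumes [measurable]: "B \<in> sets borel"
  shows "emeasure (distr M borel (U k u)) B = (avg ^^ k) (indicator B) u"
proof -
  have "emeasure (distr M borel (U k u)) B = (\<integral>\<^sup>+\<omega>. indicator B (U k u \<omega>) \<partial>M)"
    by (subst nn_integral_distr[symmetric, of _ _ borel]) auto
  then show ?thesis by (simp add: forward_law)
qed

lemma invariant_limit_law:
  "invariant_measure (\<lambda>k u. distr M borel (U k u)) limit_law"
  unfolding invariant_measure_def
proof (intro conjI allI ballI borel_prob_limit_law)
  fix k and B :: "'a set" assume B: "B \<in> sets borel"
  then have [simp]: "B \<in> sets limit_law" by (simp add: limit_law_def)
  show "emeasure limit_law B = (\<integral>\<^sup>+u. emeasure (distr M borel (U k u)) B \<partial>limit_law)"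
    using B by (simp add: emeasure_kernel limit_law_stationary_power)
qed

text \<open>Invariance is a condition on events. It extends to integrals by reading both sides as integrals with respect to the
law of \<open>U k\<close> started from an independent point distributed according to \<open>\<pi>\<close>.\<close>

lemma invariant_integral:
  assumes inv: "invariant_measure (\<lambda>k u. distr M borel (U k u)) \<pi>"
    and f: "f \<in> borel_measurable borel"
  shows "(\<integral>\<^sup>+u. f u \<partial>\<pi>) = (\<integral>\<^sup>+u. (avg ^^ k) f u \<partial>\<pi>)"
proof -
  have [measurable_cong]: "sets \<pi> = sets borel" using inv by (simp add: invariant_measure_def borel_prob_def)
  interpret p: prob_space \<pi> using inv by (simp add: invariant_measure_def borel_prob_def)
  have [measurable]: "(\<lambda>p. U j (fst p) (snd p)) \<in> borel_measurable (\<pi> \<Otimes>\<^sub>M M)" for j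
    by (induction j) simp_all
  let ?\<mu> = "distr (\<pi> \<Otimes>\<^sub>M M) borel (\<lambda>p. U k (fst p) (snd p))"
  have push: "(\<integral>\<^sup>+u. f u \<partial>?\<mu>) = (\<integral>\<^sup>+u. (avg ^^ k) f u \<partial>\<pi>)"
    if [measurable]: "f \<in> borel_measurable borel" for f
  proof -
    have "(\<integral>\<^sup>+u. f u \<partial>?\<mu>) = (\<integral>\<^sup>+p. f (U k (fst p) (snd p)) \<partial>(\<pi> \<Otimes>\<^sub>M M))"
      by (simp add: nn_integral_distr)
    also have "\<dots> = (\<integral>\<^sup>+u. (\<integral>\<^sup>+\<omega>. f (U k u \<omega>) \<partial>M) \<partial>\<pi>)"
      using nn_integral_fst[of "\<lambda>p. f (U k (fst p) (snd p))" \<pi>] by simp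
    finally show ?thesis by (simp add: forward_law)
  qed
  have "?\<mu> = \<pi>"
  proof (rule measure_eqI)
    show "sets ?\<mu> = sets \<pi>" using \<open>sets \<pi> = sets borel\<close> by simp
    fix B assume "B \<in> sets ?\<mu>"
    then have B: "B \<in> sets borel" by simp
    then have "emeasure ?\<mu> B = (\<integral>\<^sup>+u. indicator B u \<partial>?\<mu>)" by simp
    also have "\<dots> = (\<integral>\<^sup>+u. (avg ^^ k) (indicator B) u \<partial>\<pi>)" using B by (intro push) simp
    also have "\<dots> = emeasure \<pi> B"
      using inv B by (simp add: invariant_measure_def emeasure_kernel)
    finally show "emeasure ?\<mu> B = emeasure \<pi> B" .
  qed
  then show ?thesis using push[OF f] by simp
qed

text \<open>Let \<open>f\<close> be a bounded Lipschitz function. Under an invariant law \<open>\<pi>\<close> the integral of \<open>(avg ^^ k) f\<close> does not depend on \<open>k\<close>,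
while \<open>(avg ^^ k) f\<close> tends pointwise to the constant \<open>\<integral>f d limit_law\<close>; dominated convergence identifies
the two.\<close>

lemma invariant_unique:
  assumes inv: "invariant_measure (\<lambda>k u. distr M borel (U k u)) \<pi>"
  shows "\<pi> = limit_law"
proof (rule borel_prob_eqI_lipschitz)
  show bp: "borel_prob \<pi>" using inv by (simp add: invariant_measure_def)
  then have [measurable_cong]: "sets \<pi> = sets borel" by (simp add: borel_prob_def)
  interpret p: prob_space \<pi> using bp by (simp add: borel_prob_def)
  fix f :: "'a \<Rightarrow> ennreal" and K
  assume [measurable]: "f \<in> borel_measurable borel" and le: "\<And>x. f x \<le> 1" and f: "ennreal_lipschitz K f"
  let ?l = "\<integral>\<^sup>+\<omega>. f (V_lim \<omega>) \<partial>M"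
  have "(\<lambda>k. \<integral>\<^sup>+u. (avg ^^ k) f u \<partial>\<pi>) \<longlonglongrightarrow> (\<integral>\<^sup>+u. ?l \<partial>\<pi>)"
  proof (rule nn_integral_dominated_convergence[where w = "\<lambda>_. 1"])
    show "AE u in \<pi>. (\<lambda>k. (avg ^^ k) f u) \<longlonglongrightarrow> ?l"
      by (intro AE_I2 backward_lipschitz_tendsto[OF f _ le]) simp
    show "AE u in \<pi>. (avg ^^ k) f u \<le> 1" for k
      by (intro AE_I2 avg_power_le_1 le) simp
  qed (auto simp: p.emeasure_space_1)
  moreover have "(\<integral>\<^sup>+u. (avg ^^ k) f u \<partial>\<pi>) = (\<integral>\<^sup>+u. f u \<partial>\<pi>)" for k
    using invariant_integral[OF inv, of f k] by simp
  ultimately have "(\<integral>\<^sup>+u. f u \<partial>\<pi>) = (\<integral>\<^sup>+u. ?l \<partial>\<pi>)"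
    by (simp add: LIMSEQ_const_iff)
  then show "(\<integral>\<^sup>+u. f u \<partial>\<pi>) = (\<integral>\<^sup>+u. f u \<partial>limit_law)"
    by (simp add: p.emeasure_space_1 limit_law_def nn_integral_distr)
qed (rule borel_prob_limit_law)

lemma backward_distr: "distr M borel (V k u) = distr M borel (U k u)"
proof (rule measure_eqI)
  fix B assume "B \<in> sets (distr M borel (V k u))"
  then have B: "B \<in> sets borel" by simp
  have "emeasure (distr M borel (V k u)) B = (\<integral>\<^sup>+\<omega>. indicator B (V k u \<omega>) \<partial>M)"
    using B by (subst nn_integral_distr[symmetric, of _ _ borel]) auto
  then show "emeasure (distr M borel (V k u)) B = emeasure (distr M borel (U k u)) B"
    using B by (simp add: emeasure_kernel backward_law)
qed simp

lemma kernel_measurable: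
  "B \<in> sets borel \<Longrightarrow> (\<lambda>u. emeasure (distr M borel (U k u)) B) \<in> borel_measurable borel"
  by (simp add: emeasure_kernel)

end


section \<open>Conjugation and the Wasserstein bound\<close>

text \<open>Invariant laws are transported along a change of variables that intertwines the kernels. Since \<open>F\<close> is only required to
be a left inverse of \<open>T\<close>, the lemma can be used in both directions for a bijection.\<close>

lemma invariant_measure_distr:
  fixes K P :: "nat \<Rightarrow> 'a::topological_space \<Rightarrow> 'a measure"
  assumes inv: "invariant_measure K \<pi>"
    and T: "T \<in> borel_measurable borel" and F: "F \<in> borel_measurable borel"
    and FT: "\<And>u. F (T u) = u"
    and sets_K: "\<And>k u. sets (K k u) = sets borel"
    and K: "\<And>k B. B \<in> sets borel \<Longrightarrow> (\<lambda>u. emeasure (K k u) B) \<in> borel_measurable borel"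
    and P: "\<And>k x. P k x = distr (K k (F x)) borel T"
  shows "invariant_measure P (distr \<pi> borel T)"
  unfolding invariant_measure_def
proof (intro conjI allI ballI)
  interpret p: prob_space \<pi> using inv by (simp add: invariant_measure_def borel_prob_def)
  have sets_\<pi>: "sets \<pi> = sets borel" using inv by (simp add: invariant_measure_def borel_prob_def)
  have T\<pi>: "T \<in> measurable \<pi> borel" using T measurable_cong_sets[OF sets_\<pi> refl] by blast
  show "borel_prob (distr \<pi> borel T)"
    by (simp add: borel_prob_def p.prob_space_distr T\<pi>)
  fix k and B :: "'a set" assume B: "B \<in> sets borel"
  have TB: "T -` B \<in> sets borel" using measurable_sets[OF T B] by simp
  have space: "space \<pi> = UNIV" "space (K k u) = UNIV" for u
    using sets_eq_imp_space_eq[OF sets_\<pi>] sets_eq_imp_space_eq[OF sets_K[of k u]] by simp_all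
  have PB: "emeasure (P k x) B = emeasure (K k (F x)) (T -` B)" for x
  proof -
    have "T \<in> measurable (K k (F x)) borel"
      using T measurable_cong_sets[OF sets_K[of k "F x"] refl] by blast
    then show ?thesis using B by (simp add: P emeasure_distr space)
  qed
  have "emeasure (distr \<pi> borel T) B = emeasure \<pi> (T -` B)"
    using B T\<pi> by (simp add: emeasure_distr space)
  also have "\<dots> = (\<integral>\<^sup>+u. emeasure (K k u) (T -` B) \<partial>\<pi>)"
    using inv TB by (simp add: invariant_measure_def)
  also have "\<dots> = (\<integral>\<^sup>+u. emeasure (P k (T u)) B \<partial>\<pi>)"
    by (simp add: PB FT)
  also have "\<dots> = (\<integral>\<^sup>+x. emeasure (P k x) B \<partial>distr \<pi> borel T)"
    using measurable_compose[OF F K[OF TB]] by (subst nn_integral_distr[OF T\<pi>]) (auto simp: PB)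
  finally show "emeasure (distr \<pi> borel T) B = (\<integral>\<^sup>+x. emeasure (P k x) B \<partial>distr \<pi> borel T)" .
qed

text \<open>The elementary bound \<open>t\<^sup>p \<le> 1 + t\<close> for \<open>t \<ge> 0\<close>, rescaled by \<open>t = a / m\<close>. It plays the role of Jensen's
inequality for the concave function \<open>t\<^sup>p\<close> and loses only a factor \<open>2\<close>.\<close>

lemma powr_le_linear:
  fixes a m p :: real
  assumes "0 \<le> a" "0 < m" "0 < p" "p < 1"
  shows "a powr p \<le> m powr p + m powr (p - 1) * a"
proof -
  have "(a / m) powr p \<le> 1 + a / m"
  proof (cases "a \<le> m")
    case True
    then have "(a / m) powr p \<le> 1 powr p" using assms by (intro powr_mono2) auto
    then show ?thesis using assms by (simp add: add_increasing2)
  next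
    case False
    then have "(a / m) powr p \<le> (a / m) powr 1" using assms by (intro powr_mono) auto
    then show ?thesis using assms by simp
  qed
  then have "m powr p * (a / m) powr p \<le> m powr p * (1 + a / m)"
    by (intro mult_left_mono) auto
  then show ?thesis using assms
    by (simp add: powr_mult[symmetric] distrib_left powr_diff)
qed

lemma (in prob_space) wasserstein_distr_le:
  fixes X Y :: "'a \<Rightarrow> 'b::{real_normed_vector, second_countable_topology}"
  assumes [measurable]: "X \<in> borel_measurable M" "Y \<in> borel_measurable M"
    and le: "(\<integral>\<^sup>+\<omega>. dist (X \<omega>) (Y \<omega>) \<partial>M) \<le> ennreal m"
    and m: "0 < m" and p: "0 < p" "p < 1"
  shows "wasserstein p (distr M borel X) (distr M borel Y) \<le> ennreal (2 * m powr p)"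
proof -
  let ?\<nu> = "distr M (borel \<Otimes>\<^sub>M borel) (\<lambda>\<omega>. (X \<omega>, Y \<omega>))"
  have \<nu>: "?\<nu> \<in> couplings (distr M borel X) (distr M borel Y)"
    unfolding couplings_def by (auto intro!: prob_space_distr simp: distr_distr comp_def)
  have "wasserstein p (distr M borel X) (distr M borel Y)
      \<le> (\<integral>\<^sup>+z. ennreal (norm (fst z - snd z) powr p) \<partial>?\<nu>)"
    unfolding wasserstein_def by (rule INF_lower[OF \<nu>])
  also have "\<dots> = (\<integral>\<^sup>+\<omega>. ennreal (norm (X \<omega> - Y \<omega>) powr p) \<partial>M)"
    by (subst nn_integral_distr) auto
  also have "\<dots> \<le> (\<integral>\<^sup>+\<omega>. ennreal (m powr p) + ennreal (m powr (p - 1)) * ennreal (dist (X \<omega>) (Y \<omega>)) \<partial>M)"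
    using powr_le_linear[OF _ m p]
    by (intro nn_integral_mono)
      (auto simp: dist_norm ennreal_mult'[symmetric] ennreal_plus[symmetric] simp del: ennreal_plus)
  also have "\<dots> = ennreal (m powr p) + ennreal (m powr (p - 1)) * (\<integral>\<^sup>+\<omega>. dist (X \<omega>) (Y \<omega>) \<partial>M)"
    by (simp add: nn_integral_add nn_integral_cmult emeasure_space_1)
  also have "\<dots> \<le> ennreal (m powr p) + ennreal (m powr (p - 1)) * ennreal m"
    by (intro add_left_mono mult_left_mono le) simp
  also have "\<dots> = ennreal (2 * m powr p)"
    using m by (simp add: ennreal_mult'[symmetric] ennreal_plus[symmetric] powr_diff del: ennreal_plus)
  finally show ?thesis .
qed

text \<open>This follows from the pointwise bound \<open>2 m X \<le> m\<^sup>2 + X\<^sup>2\<close>.\<close>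

lemma (in prob_space) nn_integral_le_of_square_le:
  fixes X :: "'a \<Rightarrow> real"
  assumes [measurable]: "X \<in> borel_measurable M"
    and le: "(\<integral>\<^sup>+\<omega>. ennreal ((X \<omega>)\<^sup>2) \<partial>M) \<le> ennreal (m\<^sup>2)" and m: "0 < m"
  shows "(\<integral>\<^sup>+\<omega>. ennreal (X \<omega>) \<partial>M) \<le> ennreal m"
proof -
  have "X \<omega> \<le> m / 2 + 1 / (2 * m) * (X \<omega>)\<^sup>2" for \<omega>
  proof -
    have "0 \<le> (X \<omega> - m)\<^sup>2 / (2 * m)" using m by simp
    then show ?thesis using m by (simp add: field_simps power2_eq_square)
  qed
  then have "(\<integral>\<^sup>+\<omega>. ennreal (X \<omega>) \<partial>M)
      \<le> (\<integral>\<^sup>+\<omega>. ennreal (m / 2) + ennreal (1 / (2 * m)) * ennreal ((X \<omega>)\<^sup>2) \<partial>M)"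
    using m by (intro nn_integral_mono)
      (auto simp: ennreal_mult'[symmetric] ennreal_plus[symmetric] simp del: ennreal_plus intro!: ennreal_leI)
  also have "\<dots> = ennreal (m / 2) + ennreal (1 / (2 * m)) * (\<integral>\<^sup>+\<omega>. ennreal ((X \<omega>)\<^sup>2) \<partial>M)"
    by (simp add: nn_integral_add nn_integral_cmult emeasure_space_1)
  also have "\<dots> \<le> ennreal (m / 2) + ennreal (1 / (2 * m)) * ennreal (m\<^sup>2)"
    by (intro add_left_mono mult_left_mono le) simp
  also have "\<dots> = ennreal m"
    using m by (simp add: ennreal_mult'[symmetric] ennreal_plus[symmetric] power2_eq_square field_simps del: ennreal_plus)
  finally show ?thesis .
qed


section \<open>Brownian increments\<close>

lemma (in prob_space) second_moment_affine:
  fixes X :: "'i \<Rightarrow> 'a \<Rightarrow> real"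
  assumes "finite I"
    and int: "\<And>j. j \<in> I \<Longrightarrow> integrable M (X j)" and mean: "\<And>j. j \<in> I \<Longrightarrow> expectation (X j) = 0"
    and int2: "\<And>j k. j \<in> I \<Longrightarrow> k \<in> I \<Longrightarrow> integrable M (\<lambda>\<omega>. X j \<omega> * X k \<omega>)"
    and cov: "\<And>j k. j \<in> I \<Longrightarrow> k \<in> I \<Longrightarrow> expectation (\<lambda>\<omega>. X j \<omega> * X k \<omega>) = (if j = k then v else 0)"
  shows "integrable M (\<lambda>\<omega>. (c + (\<Sum>j\<in>I. a j * X j \<omega>))\<^sup>2)" (is ?int)
    and "expectation (\<lambda>\<omega>. (c + (\<Sum>j\<in>I. a j * X j \<omega>))\<^sup>2) = c\<^sup>2 + v * (\<Sum>j\<in>I. (a j)\<^sup>2)" (is ?exp)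
proof -
  have eq: "(c + (\<Sum>j\<in>I. a j * X j \<omega>))\<^sup>2 = c\<^sup>2 + (\<Sum>j\<in>I. 2 * c * a j * X j \<omega>)
      + (\<Sum>j\<in>I. \<Sum>k\<in>I. a j * a k * (X j \<omega> * X k \<omega>))" for \<omega>
    by (simp add: power2_sum) (simp add: power2_eq_square sum_product sum_distrib_left ac_simps)
  show ?int unfolding eq
    using int int2 by (intro Bochner_Integration.integrable_add Bochner_Integration.integrable_sum integrable_mult_right) auto
  have "expectation (\<lambda>\<omega>. (c + (\<Sum>j\<in>I. a j * X j \<omega>))\<^sup>2)
      = c\<^sup>2 + (\<Sum>j\<in>I. 2 * c * a j * expectation (X j))
        + (\<Sum>j\<in>I. \<Sum>k\<in>I. a j * a k * expectation (\<lambda>\<omega>. X j \<omega> * X k \<omega>))"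
    unfolding eq using int int2
    by (subst Bochner_Integration.integral_add Bochner_Integration.integral_sum | auto simp: prob_space)+
  also have "\<dots> = c\<^sup>2 + (\<Sum>j\<in>I. \<Sum>k\<in>I. if j = k then v * (a j)\<^sup>2 else 0)"
    using mean cov by (auto intro!: sum.cong simp: power2_eq_square)
  also have "\<dots> = c\<^sup>2 + v * (\<Sum>j\<in>I. (a j)\<^sup>2)"
    using \<open>finite I\<close> by (simp add: sum_distrib_left)
  finally show ?exp .
qed

lemma brownian_increment_measurable:
  assumes "brownian_motion M W" "0 \<le> r" "0 \<le> t"
  shows "(\<lambda>\<omega>. W t \<omega> - W r \<omega>) \<in> borel_measurable M"
  using assms by (intro borel_measurable_diff) (auto simp: brownian_motion_def)

text \<open>The increment is centred with covariance \<open>(t - r) I\<close>, so the mixed term vanishes and the Hilbert-Schmidt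
norm of \<open>A\<close> appears row by row.\<close>

lemma brownian_increment_second_moment:
  fixes W :: "real \<Rightarrow> 'w \<Rightarrow> real ^ 'd" and A :: "real ^ 'd ^ 'n"
  assumes bm: "brownian_motion M W" and "0 \<le> r" "r < t"
  shows "(\<integral>\<^sup>+\<omega>. ennreal ((norm (c + A *v (W t \<omega> - W r \<omega>)))\<^sup>2) \<partial>M)
    = ennreal ((norm c)\<^sup>2 + (t - r) * (norm A)\<^sup>2)"
proof -
  interpret prob_space M using bm by (simp add: brownian_motion_def)
  let ?X = "\<lambda>i \<omega>. (W t \<omega> - W r \<omega>) $ i"
  let ?\<sigma> = "sqrt (t - r)"
  have \<sigma>: "?\<sigma> > 0" using \<open>r < t\<close> by simp
  have dist: "distributed M lborel (?X i) (\<lambda>x. ennreal (normal_density 0 ?\<sigma> x))" for i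
    using bm[unfolded brownian_motion_def] \<open>0 \<le> r\<close> \<open>r < t\<close> by blast
  have ind: "indep_vars (\<lambda>_. borel) ?X UNIV"
    using bm[unfolded brownian_motion_def] \<open>0 \<le> r\<close> \<open>r < t\<close> by blast
  have int: "integrable M (?X i)" for i
    using distributed_integrable[OF dist, of "\<lambda>x. x"] integrable_normal_moment[OF \<sigma>, of 0 1] by simp
  have mean: "expectation (?X i) = 0" for i
    using distributed_integral[OF dist, of "\<lambda>x. x"] integral_normal_moment_odd[OF \<sigma>, of 0 0] by simp
  have int_sq: "integrable M (\<lambda>\<omega>. ?X i \<omega> * ?X i \<omega>)" for i
    using distributed_integrable[OF dist, of "\<lambda>x. x * x"] integrable_normal_moment[OF \<sigma>, of 0 2]
    by (simp add: power2_eq_square)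
  have var: "expectation (\<lambda>\<omega>. ?X i \<omega> * ?X i \<omega>) = t - r" for i
    using distributed_integral[OF dist, of "\<lambda>x. x * x"] integral_normal_moment_even[OF \<sigma>, of 0 1] \<open>r < t\<close>
    by (simp add: power2_eq_square fact_numeral)
  have indep: "indep_var borel (?X i) borel (?X j)" if "i \<noteq> j" for i j
    using indep_vars_sum[of "{j}" i ?X] indep_vars_subset[OF ind, of "{i, j}"] that by simp
  have int2: "integrable M (\<lambda>\<omega>. ?X i \<omega> * ?X j \<omega>)" for i j
    using int_sq indep_var_integrable[OF indep int int, of i j] by (cases "i = j") auto
  have cov: "expectation (\<lambda>\<omega>. ?X i \<omega> * ?X j \<omega>) = (if i = j then t - r else 0)" for i j
    using var indep_var_lebesgue_integral[OF indep int int, of i j] mean by auto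
  note aff = second_moment_affine[of UNIV ?X "t - r", OF finite int mean int2 cov]
  have eq: "(norm (c + A *v (W t \<omega> - W r \<omega>)))\<^sup>2 = (\<Sum>i\<in>UNIV. (c $ i + (\<Sum>j\<in>UNIV. A $ i $ j * ?X j \<omega>))\<^sup>2)" for \<omega>
    unfolding power2_norm_eq_inner inner_vec_def
    by (simp add: power2_eq_square matrix_vector_mult_def)
  have nA: "(norm A)\<^sup>2 = (\<Sum>i\<in>UNIV. \<Sum>j\<in>UNIV. (A $ i $ j)\<^sup>2)"
    and nc: "(norm c)\<^sup>2 = (\<Sum>i\<in>UNIV. (c $ i)\<^sup>2)"
    unfolding power2_norm_eq_inner by (simp_all add: inner_vec_def power2_eq_square)
  have "(\<integral>\<^sup>+\<omega>. ennreal ((norm (c + A *v (W t \<omega> - W r \<omega>)))\<^sup>2) \<partial>M)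
      = ennreal (expectation (\<lambda>\<omega>. \<Sum>i\<in>UNIV. (c $ i + (\<Sum>j\<in>UNIV. A $ i $ j * ?X j \<omega>))\<^sup>2))"
    unfolding eq using aff(1) by (intro nn_integral_eq_integral Bochner_Integration.integrable_sum AE_I2 sum_nonneg) auto
  also have "expectation (\<lambda>\<omega>. \<Sum>i\<in>UNIV. (c $ i + (\<Sum>j\<in>UNIV. A $ i $ j * ?X j \<omega>))\<^sup>2)
      = (\<Sum>i\<in>UNIV. (c $ i)\<^sup>2 + (t - r) * (\<Sum>j\<in>UNIV. (A $ i $ j)\<^sup>2))"
    using aff by (subst Bochner_Integration.integral_sum) auto
  also have "\<dots> = (norm c)\<^sup>2 + (t - r) * (norm A)\<^sup>2"
    by (simp add: nA nc sum.distrib sum_distrib_left)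
  finally show ?thesis .
qed

text \<open>The right-hand side depends on the times only through \<open>t - r\<close>, so increments over steps of equal length are
identically distributed.\<close>

lemma brownian_increment_law:
  fixes W :: "real \<Rightarrow> 'w \<Rightarrow> real ^ 'd"
  assumes bm: "brownian_motion M W" and "0 \<le> r" "r < t"
  shows "distr M borel (\<lambda>\<omega>. W t \<omega> - W r \<omega>) =
    distr (PiM UNIV (\<lambda>_::'d. density lborel (normal_density 0 (sqrt (t - r))))) borel (\<lambda>f. \<chi> i. f i)"
proof -
  interpret prob_space M using bm by (simp add: brownian_motion_def)
  let ?D = "\<lambda>\<omega>. W t \<omega> - W r \<omega>"
  have D[measurable]: "?D \<in> borel_measurable M"
    using assms by (intro brownian_increment_measurable) auto
  have comp[measurable]: "(\<lambda>\<omega>. ?D \<omega> $ i) \<in> borel_measurable M" for i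
    using measurable_compose[OF D borel_measurable_continuous_onI[of "\<lambda>x. x $ i"]]
    by (simp add: continuous_on_component continuous_on_id)
  have ind: "indep_vars (\<lambda>_. borel) (\<lambda>i \<omega>. ?D \<omega> $ i) UNIV"
    using bm[unfolded brownian_motion_def] \<open>0 \<le> r\<close> \<open>r < t\<close> by blast
  have dist: "distributed M lborel (\<lambda>\<omega>. ?D \<omega> $ i) (\<lambda>x. ennreal (normal_density 0 (sqrt (t - r)) x))" for i
    using bm[unfolded brownian_motion_def] \<open>0 \<le> r\<close> \<open>r < t\<close> by blast
  have "distr M borel (\<lambda>\<omega>. ?D \<omega> $ i) = distr M lborel (\<lambda>\<omega>. ?D \<omega> $ i)" for i
    by (rule distr_cong) auto
  then have law: "distr M borel (\<lambda>\<omega>. ?D \<omega> $ i) = density lborel (normal_density 0 (sqrt (t - r)))" for i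
    using distributed_distr_eq_density[OF dist[of i]] by simp
  have prod: "distr M (PiM UNIV (\<lambda>_. borel)) (\<lambda>\<omega>. \<lambda>i\<in>UNIV. ?D \<omega> $ i)
      = PiM UNIV (\<lambda>_::'d. density lborel (normal_density 0 (sqrt (t - r))))"
    using indep_vars_iff_distr_eq_PiM[THEN iffD1, OF _ comp ind] unfolding law by simp
  have vec[measurable]: "(\<lambda>f. \<chi> i. f i) \<in> borel_measurable (PiM UNIV (\<lambda>_::'d. borel :: real measure))"
  proof (rule borel_measurable_euclidean_space[THEN iffD2], rule ballI)
    fix v :: "real ^ 'd" assume "v \<in> Basis"
    then obtain i where v: "v = axis i 1" by (auto simp: Basis_vec_def)
    show "(\<lambda>f. inner (\<chi> i. f i) v) \<in> borel_measurable (PiM UNIV (\<lambda>_::'d. borel :: real measure))"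
      by (simp add: v inner_axis)
  qed
  have "(\<lambda>\<omega>. \<lambda>i\<in>UNIV. ?D \<omega> $ i) \<in> measurable M (PiM UNIV (\<lambda>_. borel))"
    by (intro measurable_restrict comp)
  then show ?thesis
    unfolding prod[symmetric] by (simp add: distr_distr comp_def restrict_def del: vector_minus_component)
qed


section \<open>The theta method as an average contraction\<close>

text \<open>Here \<open>e\<close> stands for the difference of two states, \<open>d\<close> and \<open>G\<close> for the difference of the drifts and the norm of the
difference of the diffusions. Replacing \<open>e - \<theta> h d\<close> by \<open>e + (1 - \<theta>) h d\<close> changes the squared norm by
\<open>2 h \<langle>e, d\<rangle> + (1 - 2 \<theta>) h\<^sup>2 |d|\<^sup>2\<close>. Monotonicity bounds the first term together with \<open>h G\<^sup>2\<close> by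
\<open>- \<beta> h |e|\<^sup>2\<close>, the second term is nonpositive for \<open>\<theta> \<ge> 1/2\<close>, and the two negative terms
absorb \<open>\<rho> h |e - \<theta> h d|\<^sup>2 \<le> \<rho> h (2 |e|\<^sup>2 + 2 \<theta>\<^sup>2 h\<^sup>2 |d|\<^sup>2)\<close>; the
spare power of \<open>h\<close> in the last term is where \<open>h < 1\<close> enters.\<close>

lemma theta_step_contraction:
  fixes e d :: "'a::real_inner" and G \<beta> \<theta> h \<rho> l :: real
  assumes mono: "2 * inner e d + l * G\<^sup>2 \<le> - \<beta> * (norm e)\<^sup>2"
    and "1 \<le> l" "0 < h" "h < 1" "0 \<le> \<rho>" "2 * \<rho> \<le> \<beta>" "2 * \<theta>\<^sup>2 * \<rho> \<le> 2 * \<theta> - 1"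
  shows "(norm (e - (\<theta> * h) *\<^sub>R d + h *\<^sub>R d))\<^sup>2 + h * G\<^sup>2
    \<le> (1 - \<rho> * h) * (norm (e - (\<theta> * h) *\<^sub>R d))\<^sup>2"
proof -
  define E D I where "E = (norm e)\<^sup>2" and "D = (norm d)\<^sup>2" and "I = inner e d"
  have E: "0 \<le> E" and D: "0 \<le> D" by (auto simp: E_def D_def)
  have n1: "(norm (e - (\<theta> * h) *\<^sub>R d))\<^sup>2 = E - 2 * \<theta> * h * I + \<theta>\<^sup>2 * h\<^sup>2 * D"
    unfolding E_def D_def I_def power2_norm_eq_inner
    by (simp add: inner_diff inner_commute power2_eq_square algebra_simps)
  have n2: "(norm (e - (\<theta> * h) *\<^sub>R d + h *\<^sub>R d))\<^sup>2
      = (norm (e - (\<theta> * h) *\<^sub>R d))\<^sup>2 + 2 * h * I + (1 - 2 * \<theta>) * h\<^sup>2 * D"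
    unfolding E_def D_def I_def power2_norm_eq_inner
    by (simp add: inner_diff inner_add inner_commute power2_eq_square algebra_simps)
  \<comment> \<open>Expanding the square gives \<open>|e - \<theta> h d|\<^sup>2 \<le> 2 |e|\<^sup>2 + 2 |\<theta> h d|\<^sup>2\<close>.\<close>
  have "0 \<le> (norm (e + (\<theta> * h) *\<^sub>R d))\<^sup>2" by simp
  also have "\<dots> = E + 2 * \<theta> * h * I + \<theta>\<^sup>2 * h\<^sup>2 * D"
    unfolding E_def D_def I_def power2_norm_eq_inner
    by (simp add: inner_add inner_commute power2_eq_square algebra_simps)
  finally have n1_le: "(norm (e - (\<theta> * h) *\<^sub>R d))\<^sup>2 \<le> 2 * E + 2 * \<theta>\<^sup>2 * h\<^sup>2 * D"
    unfolding n1 by linarith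
  have "1 * G\<^sup>2 \<le> l * G\<^sup>2" using \<open>1 \<le> l\<close> by (intro mult_right_mono) auto
  then have "2 * I + G\<^sup>2 \<le> - \<beta> * E" using mono by (simp add: I_def E_def)
  then have "h * (2 * I + G\<^sup>2) \<le> h * (- \<beta> * E)" using \<open>0 < h\<close> by (intro mult_left_mono) auto
  moreover have "\<rho> * h * (norm (e - (\<theta> * h) *\<^sub>R d))\<^sup>2 \<le> h * (\<beta> * E) + (2 * \<theta> - 1) * h\<^sup>2 * D"
  proof -
    have "\<rho> * h * (norm (e - (\<theta> * h) *\<^sub>R d))\<^sup>2 \<le> \<rho> * h * (2 * E + 2 * \<theta>\<^sup>2 * h\<^sup>2 * D)"
      using n1_le assms by (intro mult_left_mono) auto
    also have "\<dots> = h * (2 * \<rho> * E) + h * (2 * \<theta>\<^sup>2 * \<rho> * (h\<^sup>2 * D))"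
      by (simp add: algebra_simps)
    also have "h * (2 * \<rho> * E) \<le> h * (\<beta> * E)"
      using assms E by (intro mult_left_mono mult_right_mono) auto
    also have "h * (2 * \<theta>\<^sup>2 * \<rho> * (h\<^sup>2 * D)) \<le> 1 * (2 * \<theta>\<^sup>2 * \<rho> * (h\<^sup>2 * D))"
      using assms D by (intro mult_right_mono) auto
    also have "1 * (2 * \<theta>\<^sup>2 * \<rho> * (h\<^sup>2 * D)) \<le> (2 * \<theta> - 1) * (h\<^sup>2 * D)"
      using assms D by (simp add: mult_right_mono)
    finally show ?thesis by (simp add: mult.assoc)
  qed
  ultimately show ?thesis
    unfolding n2 by (simp add: algebra_simps)
qed

lemma continuous_on_UNIV_polynomial_lipschitz:
  fixes f :: "'a::real_normed_vector \<Rightarrow> 'b::real_normed_vector"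
  assumes q: "1 < q"
    and lip: "\<And>x y. norm (f x - f y) \<le> L * (1 + norm x powr (q - 1) + norm y powr (q - 1)) * norm (x - y)"
  shows "continuous_on UNIV f"
proof (rule continuous_at_imp_continuous_on, rule ballI)
  fix x :: 'a
  have "((\<lambda>y. L * (1 + norm y powr (q - 1) + norm x powr (q - 1)) * norm (y - x))
      \<longlongrightarrow> L * (1 + norm x powr (q - 1) + norm x powr (q - 1)) * norm (x - x)) (at x)"
    using q by (intro tendsto_intros tendsto_powr') auto
  then have "((\<lambda>y. f y - f x) \<longlongrightarrow> 0) (at x)"
    using q by (intro Lim_null_comparison[OF always_eventually[OF allI[OF lip]]]) simp
  then show "isCont f x"
    by (simp add: isCont_def LIM_zero_iff)
qed

theorem theorem3p3:
  fixes b :: "real ^ 'n \<Rightarrow> real ^ 'n"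
    and g :: "real ^ 'n \<Rightarrow> real ^ 'd ^ 'n"
    and M :: "'w measure"
    and W :: "real \<Rightarrow> 'w \<Rightarrow> real ^ 'd"
    and L q l\<^sub>1 \<beta> l\<^sub>2 c\<^sub>1 \<alpha> \<theta> \<rho>\<^sub>0 \<rho>\<^sub>0' h_star h :: real
  assumes "prob_space M" and "complete_measure M" and "brownian_motion M W"
    and "L > 0" and "q > 1"
    and "\<And>x\<^sub>1 x\<^sub>2. max (norm (b x\<^sub>1 - b x\<^sub>2)) (norm (g x\<^sub>1 - g x\<^sub>2))
           \<le> L * (1 + norm x\<^sub>1 powr (q - 1) + norm x\<^sub>2 powr (q - 1)) * norm (x\<^sub>1 - x\<^sub>2)"
    and "l\<^sub>1 \<ge> 1" and "\<beta> > 0"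
    and "\<And>x\<^sub>1 x\<^sub>2. 2 * inner (x\<^sub>1 - x\<^sub>2) (b x\<^sub>1 - b x\<^sub>2) + l\<^sub>1 * (norm (g x\<^sub>1 - g x\<^sub>2))\<^sup>2
           \<le> - \<beta> * (norm (x\<^sub>1 - x\<^sub>2))\<^sup>2"
    and "l\<^sub>2 \<ge> 1" and "c\<^sub>1 > 0" and "\<alpha> > 0"
    and "\<And>x. 2 * inner x (b x) + l\<^sub>2 * (norm (g x))\<^sup>2 \<le> c\<^sub>1 - \<alpha> * (norm x)\<^sup>2"
    and "1 / 2 < \<theta>" and "\<theta> \<le> 1"
    and "\<rho>\<^sub>0 = min (\<alpha> / 2) ((2 * \<theta> - 1) / (2 * \<theta>\<^sup>2))"
    and "\<rho>\<^sub>0' = min (\<beta> / 2) ((2 * \<theta> - 1) / (2 * \<theta>\<^sup>2))"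
    and "h_star = min (1 / \<rho>\<^sub>0) (1 / \<rho>\<^sub>0')"
    and "0 < h" and "h < 1" and "h < h_star"
  shows "\<exists>\<pi>. invariant_measure (theta_kernel b g \<theta> h M W) \<pi> \<and>
           (\<forall>\<pi>'. invariant_measure (theta_kernel b g \<theta> h M W) \<pi>' \<longrightarrow> \<pi>' = \<pi>) \<and>
           (\<exists>\<xi>\<^sub>1>0. \<forall>p. 0 < p \<and> p < 1 \<longrightarrow>
             (\<forall>x\<^sub>0. \<exists>C>0. \<forall>k\<ge>1.
                wasserstein p (theta_kernel b g \<theta> h M W k x\<^sub>0) \<pi>
                  \<le> ennreal (C * exp (- p * \<xi>\<^sub>1 * real k * h))))"
proof -
  interpret prob_space M by fact
  note bm = \<open>brownian_motion M W\<close>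
    and lip = assms(6) and mono = assms(9)
    and \<theta> = \<open>1 / 2 < \<theta>\<close> \<open>\<theta> \<le> 1\<close>
    and h = \<open>0 < h\<close> \<open>h < 1\<close>
  have cont_b: "continuous_on UNIV b" and cont_g: "continuous_on UNIV g"
    by (rule continuous_on_UNIV_polynomial_lipschitz[OF \<open>q > 1\<close>, of _ L]; use lip in force)+

  have \<rho>: "0 < \<rho>\<^sub>0'" "2 * \<rho>\<^sub>0' \<le> \<beta>" "2 * \<theta>\<^sup>2 * \<rho>\<^sub>0' \<le> 2 * \<theta> - 1"
  proof -
    show "0 < \<rho>\<^sub>0'" "2 * \<rho>\<^sub>0' \<le> \<beta>"
      using \<theta> \<open>\<beta> > 0\<close> by (auto simp: assms(17))
    have "\<rho>\<^sub>0' \<le> (2 * \<theta> - 1) / (2 * \<theta>\<^sup>2)" by (simp add: assms(17))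
    then show "2 * \<theta>\<^sup>2 * \<rho>\<^sub>0' \<le> 2 * \<theta> - 1"
      using \<theta> by (simp add: pos_le_divide_eq mult.commute)
  qed
  have \<rho>h: "0 < \<rho>\<^sub>0' * h" "\<rho>\<^sub>0' * h < 1"
    using \<rho> h \<open>h < h_star\<close> by (auto simp: assms(18) pos_less_divide_eq mult.commute)
  define s where "s = sqrt (1 - \<rho>\<^sub>0' * h)"
  have s: "0 < s" "s < 1" "s\<^sup>2 = 1 - \<rho>\<^sub>0' * h"
    using \<rho>h by (auto simp: s_def)

  define F where "F x = x - (\<theta> * h) *\<^sub>R b x" for x
  have mono0: "inner (x - y) (b x - b y) \<le> 0" for x y
  proof -
    have "0 \<le> l\<^sub>1 * (norm (g x - g y))\<^sup>2" "0 \<le> \<beta> * (norm (x - y))\<^sup>2"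
      using \<open>l\<^sub>1 \<ge> 1\<close> \<open>\<beta> > 0\<close> by auto
    then show ?thesis using mono[of x y] by linarith
  qed
  \<comment> \<open>Every right-hand side \<open>u\<close> of the implicit equation is reached from the state \<open>0\<close> by a suitable
    noise term.\<close>
  have F_ex1: "\<exists>!y. F y = u" for u
  proof -
    have "\<exists>!y. y = 0 + (\<theta> * h) *\<^sub>R b y + ((1 - \<theta>) * h) *\<^sub>R b 0 + (u - ((1 - \<theta>) * h) *\<^sub>R b 0)"
      by (rule theta_step_ex1[OF cont_b mono0]) (use \<theta> h in auto)
    then show ?thesis by (simp add: F_def diff_eq_eq add.commute)
  qed
  define T where "T = inv F"
  have "bij F" using F_ex1 by (auto simp: bij_iff)
  then have FT: "F (T u) = u" and TF: "T (F x) = x" for u x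
    by (simp_all add: T_def bij_is_surj surj_f_inv_f bij_is_inj)
  have F_expands: "norm (x - y) \<le> norm (F x - F y)" for x y
  proof -
    have "(norm (x - y))\<^sup>2 \<le> inner (x - y) (F x - F y)"
      using mult_nonneg_nonpos[OF _ mono0[of x y], of "\<theta> * h"] \<theta> h
      by (simp add: F_def power2_norm_eq_inner inner_diff algebra_simps)
    also have "\<dots> \<le> norm (x - y) * norm (F x - F y)" by (rule norm_cauchy_schwarz)
    finally show ?thesis by (cases "x = y") (auto simp: power2_eq_square)
  qed
  have T_lip: "dist (T u) (T v) \<le> dist u v" for u v
    using F_expands[of "T u" "T v"] by (simp add: FT dist_norm)
  have cont_F: "continuous_on UNIV F"
    unfolding F_def by (intro continuous_intros cont_b)
  have cont_T: "continuous_on UNIV T"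
    unfolding continuous_on_iff using T_lip by (meson order_le_less_trans UNIV_I)
  have F_meas[measurable]: "F \<in> borel_measurable borel" and T_meas[measurable]: "T \<in> borel_measurable borel"
    by (intro borel_measurable_continuous_onI cont_F cont_T)+

  define \<xi> where "\<xi> k \<omega> = W (real (Suc k) * h) \<omega> - W (real k * h) \<omega>" for k \<omega>
  define N where "N = distr M borel (\<xi> 0)"
  define \<Psi> where "\<Psi> u w = u + h *\<^sub>R b (T u) + g (T u) *v w" for u w
  have times: "0 \<le> real k * h" "real k * h < real (Suc k) * h" "real (Suc k) * h - real k * h = h" for k
    using h by (auto simp: algebra_simps)
  have [measurable]: "\<xi> k \<in> borel_measurable M" for k
    unfolding \<xi>_def[abs_def] using times[of k] by (intro brownian_increment_measurable[OF bm]) auto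
  have second_moment: "(\<integral>\<^sup>+\<omega>. ennreal ((norm (c + A *v \<xi> k \<omega>))\<^sup>2) \<partial>M) = ennreal ((norm c)\<^sup>2 + h * (norm A)\<^sup>2)"
    for c and A :: "real ^ 'd ^ 'n" and k
    unfolding \<xi>_def using brownian_increment_second_moment[OF bm times(1,2)] by (simp add: times(3) del: of_nat_Suc)
  have cont_\<Psi>: "continuous_on UNIV (\<lambda>p. \<Psi> (fst p) (snd p))"
    unfolding \<Psi>_def matrix_vector_mult_def
    by (intro continuous_intros continuous_on_vec_lambda
        continuous_on_compose2[OF cont_b] continuous_on_compose2[OF cont_g] continuous_on_compose2[OF cont_T]) auto
  then have \<Psi>_meas: "(\<lambda>(u, w). \<Psi> u w) \<in> borel_measurable (borel \<Otimes>\<^sub>M borel)"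
    using borel_measurable_continuous_onI[OF cont_\<Psi>] by (simp add: borel_prod case_prod_beta')
  have \<Psi>_meas1[measurable]: "\<Psi> u \<in> borel_measurable borel" for u
    using measurable_compose[OF measurable_Pair1' \<Psi>_meas, of u] by simp

  interpret C: average_contraction M borel N \<xi> \<Psi> s
  proof unfold_locales
    fix k
    have "mono (\<lambda>i. real i * h)" using h by (auto simp: mono_def)
    then show "indep_vars (\<lambda>_. borel) \<xi> {..<k}"
      using bm[unfolded brownian_motion_def] unfolding \<xi>_def[abs_def]
      by (elim conjE allE[where x = "\<lambda>i. real i * h"]) simp
    show "distr M borel (\<xi> k) = N"
      unfolding N_def \<xi>_def[abs_def]
      by (simp only: brownian_increment_law[OF bm times(1,2)] times(3))
  next
    fix u v
    show "(\<integral>\<^sup>+w. dist (\<Psi> u w) (\<Psi> v w) \<partial>N) \<le> ennreal (s * dist u v)"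
    proof (cases "u = v")
      case False
      define e d A where "e = T u - T v" and "d = b (T u) - b (T v)" and "A = g (T u) - g (T v)"
      have uv: "u - v = e - (\<theta> * h) *\<^sub>R d"
        using FT[of u, symmetric] FT[of v, symmetric] by (simp add: e_def d_def F_def algebra_simps)
      have diff: "dist (\<Psi> u w) (\<Psi> v w) = norm ((u - v + h *\<^sub>R d) + A *v w)" for w
        by (simp add: dist_norm \<Psi>_def d_def A_def matrix_vector_mult_diff_rdistrib algebra_simps)
      have "(norm (u - v + h *\<^sub>R d))\<^sup>2 + h * (norm A)\<^sup>2 \<le> (1 - \<rho>\<^sub>0' * h) * (norm (u - v))\<^sup>2"
        unfolding uv using mono[of "T u" "T v"] \<rho> h \<open>l\<^sub>1 \<ge> 1\<close>
        by (intro theta_step_contraction[where l = l\<^sub>1 and \<beta> = \<beta>]) (auto simp: e_def d_def A_def)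
      then have "(\<integral>\<^sup>+\<omega>. ennreal ((dist (\<Psi> u (\<xi> 0 \<omega>)) (\<Psi> v (\<xi> 0 \<omega>)))\<^sup>2) \<partial>M) \<le> ennreal ((s * dist u v)\<^sup>2)"
        unfolding diff second_moment by (intro ennreal_leI) (simp add: power_mult_distrib s dist_norm)
      then have "(\<integral>\<^sup>+\<omega>. ennreal (dist (\<Psi> u (\<xi> 0 \<omega>)) (\<Psi> v (\<xi> 0 \<omega>))) \<partial>M) \<le> ennreal (s * dist u v)"
      proof (rule nn_integral_le_of_square_le[rotated])
        show "0 < s * dist u v" using False s by simp
        show "(\<lambda>\<omega>. dist (\<Psi> u (\<xi> 0 \<omega>)) (\<Psi> v (\<xi> 0 \<omega>))) \<in> borel_measurable M"
          by measurable
      qed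
      then show ?thesis unfolding N_def by (subst nn_integral_distr) measurable
    qed simp
  next
    define c where "c = h *\<^sub>R b (T 0)"
    \<comment> \<open>Adding \<open>1\<close> keeps \<open>m\<close> positive when the drift and the diffusion both vanish at \<open>T 0\<close>.\<close>
    define m where "m = sqrt ((norm c)\<^sup>2 + h * (norm (g (T 0)))\<^sup>2 + 1)"
    have nn: "0 \<le> (norm c)\<^sup>2 + h * (norm (g (T 0)))\<^sup>2" using h by simp
    then have m: "0 < m" "m\<^sup>2 = (norm c)\<^sup>2 + h * (norm (g (T 0)))\<^sup>2 + 1"
      by (auto simp: m_def add_nonneg_pos)
    have \<Psi>0: "\<Psi> 0 w = c + g (T 0) *v w" for w by (simp add: \<Psi>_def c_def)
    have "(\<integral>\<^sup>+\<omega>. ennreal ((norm (\<Psi> 0 (\<xi> 0 \<omega>)))\<^sup>2) \<partial>M) \<le> ennreal (m\<^sup>2)"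
      unfolding \<Psi>0 second_moment m by (intro ennreal_leI) simp
    then have "(\<integral>\<^sup>+\<omega>. ennreal (norm (\<Psi> 0 (\<xi> 0 \<omega>))) \<partial>M) \<le> ennreal m"
      by (rule nn_integral_le_of_square_le[rotated]) (use m in measurable)
    moreover have "(\<integral>\<^sup>+w. dist (\<Psi> 0 w) 0 \<partial>N) = (\<integral>\<^sup>+\<omega>. ennreal (norm (\<Psi> 0 (\<xi> 0 \<omega>))) \<partial>M)"
      unfolding N_def by (subst nn_integral_distr) simp_all
    ultimately show "(\<integral>\<^sup>+w. dist (\<Psi> 0 w) 0 \<partial>N) < \<infinity>"
      by (simp add: order_le_less_trans)
  qed (use s \<Psi>_meas in auto)

  have theta_method_eq: "theta_method b g \<theta> h W x k \<omega> = T (C.U k (F x) \<omega>)" for x k \<omega>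
  proof (induction k)
    case (Suc k)
    let ?x = "T (C.U k (F x) \<omega>)"
    have "(y = ?x + (\<theta> * h) *\<^sub>R b y + ((1 - \<theta>) * h) *\<^sub>R b ?x + g ?x *v \<xi> k \<omega>)
        \<longleftrightarrow> F y = F ?x + h *\<^sub>R b ?x + g ?x *v \<xi> k \<omega>" for y
      by (auto simp: F_def algebra_simps)
    moreover have "F y = v \<longleftrightarrow> y = T v" for y v
      using FT TF by metis
    ultimately have "(THE y. y = ?x + (\<theta> * h) *\<^sub>R b y + ((1 - \<theta>) * h) *\<^sub>R b ?x + g ?x *v \<xi> k \<omega>)
        = T (C.U (Suc k) (F x) \<omega>)"
      by (simp add: \<Psi>_def FT)
    then show ?case by (simp add: Suc.IH Let_def \<xi>_def)
  qed (simp add: TF)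

  let ?K = "\<lambda>k u. distr M borel (C.U k u)" and ?P = "theta_kernel b g \<theta> h M W"
  have kernel: "?P k x = distr (?K k (F x)) borel T" for k x
    by (simp add: theta_kernel_def theta_method_eq[abs_def] distr_distr comp_def)
  have kernel': "?K k u = distr (?P k (T u)) borel F" for k u
    by (simp add: kernel distr_distr comp_def FT)
  have P_meas: "(\<lambda>x. emeasure (?P k x) B) \<in> borel_measurable borel" if B: "B \<in> sets borel" for k B
  proof -
    have TB: "T -` B \<in> sets borel" using B measurable_sets[of T borel borel B] by simp
    have "emeasure (?P k x) B = emeasure (?K k (F x)) (T -` B)" for x
      unfolding kernel using B by (subst emeasure_distr) auto
    then show ?thesis
      using measurable_compose[OF _ C.kernel_measurable[OF TB], of F borel] by simp
  qed
  have sets_P: "sets (?P k x) = sets borel" for k x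
    by (simp add: theta_kernel_def)
  define \<pi> where "\<pi> = distr C.limit_law borel T"
  have inv: "invariant_measure ?P \<pi>"
    unfolding \<pi>_def
    by (rule invariant_measure_distr[OF C.invariant_limit_law, where F = F])
      (auto simp: FT kernel C.kernel_measurable)
  have unique: "\<pi>' = \<pi>" if \<pi>': "invariant_measure ?P \<pi>'" for \<pi>'
  proof -
    have [measurable_cong]: "sets \<pi>' = sets borel"
      using \<pi>' by (simp add: invariant_measure_def borel_prob_def)
    have "invariant_measure ?K (distr \<pi>' borel F)"
      by (rule invariant_measure_distr[OF \<pi>' F_meas T_meas TF sets_P P_meas kernel'])
    then have "C.limit_law = distr \<pi>' borel F"
      using C.invariant_unique by simp
    then have "\<pi> = distr \<pi>' borel (\<lambda>x. T (F x))"
      by (simp add: \<pi>_def distr_distr comp_def)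
    also have "\<dots> = \<pi>'" using \<open>sets \<pi>' = sets borel\<close> by (simp add: TF distr_id2)
    finally show ?thesis by simp
  qed

  \<comment> \<open>The rate is chosen so that \<open>s ^ k = exp (- r k h)\<close>.\<close>
  define r where "r = - ln s / h"
  have r: "0 < r" and s_pow: "s ^ k = exp (- r * real k * h)" for k
  proof -
    show "0 < r" using s h ln_less_zero[of s] by (simp add: r_def divide_neg_pos)
    have "exp (- r * real k * h) = exp (real k * ln s)" using h by (simp add: r_def)
    then show "s ^ k = exp (- r * real k * h)" using s by (simp add: exp_of_nat_mult)
  qed
  have conv: "\<exists>C>0. \<forall>k. wasserstein p (?P k x\<^sub>0) \<pi> \<le> ennreal (C * exp (- p * r * real k * h))"
    if p: "0 < p" "p < 1" for p x\<^sub>0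
  proof (intro exI conjI allI)
    \<comment> \<open>The summand \<open>1\<close> makes \<open>D\<close> positive also when the chain starts at \<open>0\<close> and stays there.\<close>
    define D where "D = dist (F x\<^sub>0) 0 + C.first_step / (1 - s) + 1"
    have D: "0 < D" using C.first_step_nonneg s by (simp add: D_def add_nonneg_pos)
    show "0 < 2 * D powr p" using D by simp
    fix k
    have "?P k x\<^sub>0 = distr (distr M borel (C.V k (F x\<^sub>0))) borel T"
      by (simp add: kernel C.backward_distr)
    then have law: "?P k x\<^sub>0 = distr M borel (\<lambda>\<omega>. T (C.V k (F x\<^sub>0) \<omega>))"
      by (simp add: distr_distr comp_def)
    have lim: "\<pi> = distr M borel (\<lambda>\<omega>. T (C.V_lim \<omega>))"
      by (simp add: \<pi>_def C.limit_law_def distr_distr comp_def)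
    have "(\<integral>\<^sup>+\<omega>. dist (T (C.V k (F x\<^sub>0) \<omega>)) (T (C.V_lim \<omega>)) \<partial>M)
        \<le> (\<integral>\<^sup>+\<omega>. dist (C.V k (F x\<^sub>0) \<omega>) (C.V_lim \<omega>) \<partial>M)"
      by (intro nn_integral_mono ennreal_leI T_lip)
    also have "\<dots> \<le> ennreal ((dist (F x\<^sub>0) 0 + C.first_step / (1 - s)) * s ^ k)"
      by (rule C.V_lim_dist_le)
    also have "\<dots> \<le> ennreal (D * s ^ k)"
      using s by (intro ennreal_leI mult_right_mono) (auto simp: D_def)
    finally have "wasserstein p (?P k x\<^sub>0) \<pi> \<le> ennreal (2 * (D * s ^ k) powr p)"
      unfolding law lim using D s p by (intro wasserstein_distr_le) auto
    also have "2 * (D * s ^ k) powr p = 2 * D powr p * exp (- p * r * real k * h)"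
      using D by (simp add: s_pow powr_mult exp_powr_real mult_ac)
    finally show "wasserstein p (?P k x\<^sub>0) \<pi> \<le> ennreal (2 * D powr p * exp (- p * r * real k * h))" .
  qed
  show ?thesis
  proof (intro exI[of _ \<pi>] conjI inv allI impI)
    show "\<pi>' = \<pi>" if "invariant_measure ?P \<pi>'" for \<pi>' using that by (rule unique)
    show "\<exists>\<xi>\<^sub>1>0. \<forall>p. 0 < p \<and> p < 1 \<longrightarrow> (\<forall>x\<^sub>0. \<exists>C>0. \<forall>k\<ge>1.
        wasserstein p (?P k x\<^sub>0) \<pi> \<le> ennreal (C * exp (- p * \<xi>\<^sub>1 * real k * h)))"
    proof (rule exI[of _ r], intro conjI r allI impI)
      fix p :: real and x\<^sub>0 :: "real ^ 'n" assume "0 < p \<and> p < 1"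
      then obtain C where C: "0 < C"
        "\<And>k. wasserstein p (?P k x\<^sub>0) \<pi> \<le> ennreal (C * exp (- p * r * real k * h))"
        using conv by metis
      show "\<exists>C>0. \<forall>k\<ge>1. wasserstein p (?P k x\<^sub>0) \<pi> \<le> ennreal (C * exp (- p * r * real k * h))"
        by (intro exI[of _ C] conjI allI impI C)
    qed
  qed
qed

end
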